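(* Consider the two-player single-controller constrained stochastic game $G^c$ with average cost criterion described in the context. Let $\eta=(v,u^T,z^T,f^T,x^T,(\delta^1)^T,(\delta^2)^T)^T$ with $v\in\mathbb{R}$, $u=(u(s))_{s\in S}$, $z=(z(s))_{s\in S}$, $f=(f(s,a^1))_{(s,a^1)\in\mathcal{K}^1}$, $x=(x(s,a^2))_{(s,a^2)\in\mathcal{K}^2}$, $\delta^1=(\delta^1_k)_{k=1}^{n_1}$, $\delta^2=(\delta^2_l)_{l=1}^{n_2}$ real vectors, and let [MP1] be the problem of minimizing $$\Phi(\eta)=\Big[\sum_{s\in S}\sum_{a^1\in A^1(s)}\sum_{a^2\in A^2(s)} f(s,a^1)c^1(s,a^1,a^2)x(s,a^2)-\Big(\sum_{s\in S}z(s)-\sum_{k=1}^{n_1}\delta^1_k\xi^1_k\Big)\Big]+\Big[\sum_{s\in S}\sum_{a^1\in A^1(s)}\sum_{a^2\in A^2(s)} f(s,a^1)c^2(s,a^1,a^2)x(s,a^2)-\Big(v-\sum_{l=1}^{n_2}\delta^2_l\xi^2_l\Big)\Big]$$ over all $\eta$ subject to (i) $v+u(s)\le \sum_{a^1\in A^1(s)}f(s,a^1)c^2(s,a^1,a^2)+\sum_{l=1}^{n_2}\delta^2_l\sum_{a^1\in A^1(s)}f(s,a^1)d^{2,l}(s,a^1,a^2)+\sum_{s'\in S}p(s'|s,a^2)u(s')$ for all $s\in S$, $a^2\in A^2(s)$; (ii) $z(s)\le\sum_{a^2\in A^2(s)}c^1(s,a^1,a^2)x(s,a^2)+\sum_{k=1}^{n_1}\delta^1_k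 d^{1,k}_{sub}(s,a^1)$ for all $s\in S$, $a^1\in A^1(s)$; (iii) $\sum_{(s,a^2)\in\mathcal{K}^2}[\delta(s,s')-p(s'|s,a^2)]x(s,a^2)=0$ for all $s'\in S$; (iv) $\sum_{(s,a^2)\in\mathcal{K}^2}x(s,a^2)=1$; (v) $\sum_{(s,a^1)\in\mathcal{K}^1}d^{1,k}_{sub}(s,a^1)f(s,a^1)\le\xi^1_k$ for all $k=1,\dots,n_1$; (vi) $\sum_{s\in S}\sum_{a^1\in A^1(s)}\sum_{a^2\in A^2(s)}f(s,a^1)d^{2,l}(s,a^1,a^2)x(s,a^2)\le\xi^2_l$ for all $l=1,\dots,n_2$; (vii) $\sum_{a^1\in A^1(s)}f(s,a^1)=1$ for all $s\in S$; (viii) $f(s,a^1)\ge0$ for all $s\in S$, $a^1\in A^1(s)$; (ix) $x(s,a^2)\ge0$ for all $s\in S$, $a^2\in A^2(s)$; (x) $\delta^1_k\ge0$ for all $k=1,\dots,n_1$; (xi) $\delta^2_l\ge0$ for all $l=1,\dots,n_2$. Then: (a) If $(f^*,g^* )$ is a (stationary) Nash equilibrium of $G^c$ with average cost criterion, then there exists a vector $\eta^*=(v^*,u^{*T},z^{*T},f^{*T},x^{*T},(\delta^{1*})^T,(\delta^{2*})^T)^T$ (whose $f$-component is the given $f^*$) that is a global minimum of [MP1] with $\Phi(\eta^* )=0$. (b) If $\eta^*=(v^*,u^{*T},z^{*T},f^{*T},x^{*T},(\delta^{1*})^T,(\delta^{2*})^T)^T$ is a global minimum of [MP1] with $\Phi(\eta^*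 )=0$, then $(f^*,g^* )$ is a Nash equilibrium of $G^c$ with average cost criterion, where for all $s\in S$, $a^2\in A^2(s)$ $$g^*(s,a^2)=\frac{x^*(s,a^2)}{\sum_{b\in A^2(s)}x^*(s,b)}$$ whenever the denominator is nonzero (when it is zero, $g^*(s)$ is chosen arbitrarily from the probability measures on $A^2(s)$).
   Context: Game data. $S$ is a finite state space; $\gamma$ is a probability distribution on $S$ (initial distribution); for $i=1,2$ and $s\in S$, $A^i(s)$ is the finite nonempty set of actions of player $i$ at $s$. Put $\mathcal{K}=\{(s,a^1,a^2):s\in S,a^1\in A^1(s),a^2\in A^2(s)\}$ and $\mathcal{K}^i=\{(s,a^i):s\in S,a^i\in A^i(s)\}$. Given are: immediate costs $c^i:\mathcal{K}\to\mathbb{R}$, $i=1,2$; subscription costs $d^{1,k}_{sub}:\mathcal{K}^1\to\mathbb{R}$, $k=1,\dots,n_1$, of player 1; constraint costs $d^{2,l}:\mathcal{K}\to\mathbb{R}$, $l=1,\dots,n_2$, of player 2; bounds $\xi^1_k,\xi^2_l\in\mathbb{R}$; and transition probabilities $p(\cdot|s,a^2)$, a probability measure on $S$ for each $(s,a^2)\in\mathcal{K}^2$ (only player 2 controls the transitions). $\delta(s,s')$ is the Kronecker delta. Strategies. At each time $t=0,1,2,\dots$ both players observe the state and independently choose actions. A history-dependent (behavioral) strategy of a player assigns to each history $(s_0,a^1_0,a^2_0,\dots,s_{t-1},a^1_{t-1},a^2_{t-1},s_t)$ a probability measure on that player's actions at $s_t$. A stationary strategy of player 1 is $f=(f(s,a^1))$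 with $f(s,\cdot)$ a probability measure on $A^1(s)$ for each $s$; a stationary strategy of player 2 is $g=(g(s,a^2))$ similarly. The sets of stationary strategies are $F_S$ and $G_S$. With the initial distribution $\gamma$ and a strategy pair, let $\mathbb{E}$ be the expectation for the induced process $\{X_t,\mathbb{A}^1_t,\mathbb{A}^2_t\}_{t\ge0}$ of states and actions. Costs and constraints (average criterion). For $f\in F_S$ and any history-dependent strategy $g^h$ of player 2, $$C^i(\gamma,f,g^h)=\limsup_{T\to\infty}\frac1T\sum_{t=0}^{T-1}\mathbb{E}^\gamma_{f,g^h}c^i(X_t,\mathbb{A}^1_t,\mathbb{A}^2_t),\qquad D^{2,l}(\gamma,f,g^h)=\limsup_{T\to\infty}\frac1T\sum_{t=0}^{T-1}\mathbb{E}^\gamma_{f,g^h}d^{2,l}(X_t,\mathbb{A}^1_t,\mathbb{A}^2_t).$$ The pair $(f,g^h)$ is 1-feasible if $\sum_{s\in S}\sum_{a^1\in A^1(s)}d^{1,k}_{sub}(s,a^1)f(s,a^1)\le\xi^1_k$ for all $k=1,\dots,n_1$; it is 2-feasible if $D^{2,l}(\gamma,f,g^h)\le\xi^2_l$ for all $l=1,\dots,n_2$; it is feasible if both hold. Nash equilibrium. A feasible pair $(f^*,g^* )\in F_S\times G_S$ is a Nash equilibrium of $G^c$ if $C^1(\gamma,f^*,g^* )\le C^1(\gamma,f,g^* )$ for every $f\in F_S$ with $(f,g^* )$ 1-feasible, and $C^2(\gamma,f^*,g^* )\le C^2(\gamma,f^*,g^h)$ for every history-dependent $g^h$ with $(f^*,g^h)$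 2-feasible. Standing assumptions. The set of feasible stationary pairs is nonempty. (A1) Under every $g\in G_S$ the state process is a Markov chain with exactly one ergodic (recurrent) class and possibly some transient states. (A2) Strong Slater condition: there exists $g'\in G_S$ such that for every $f\in F_S$, $D^{2,l}(\gamma,f,g')<\xi^2_l$ for all $l=1,\dots,n_2$. A global minimum of [MP1] means a feasible point at which $\Phi$ is minimal over all feasible points. *)

theory Defs
  imports "HOL-Probability.Probability"
begin

text \<open>
  The state space is the finite type \<open>'s\<close>.  Actions live in types \<open>'a\<close> (player 1) and \<open>'b\<close>
  (player 2); values of the data outside the admissible actions are irrelevant.
  The indices of the subscription and cost constraints range over \<open>{1..num_sub G}\<close> and
  \<open>{1..num_con G}\<close>.
\<close>

record ('s, 'a, 'b) game =
  init :: "'s pmf"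
  act1 :: "'s \<Rightarrow> 'a set"
  act2 :: "'s \<Rightarrow> 'b set"
  cost1 :: "'s \<Rightarrow> 'a \<Rightarrow> 'b \<Rightarrow> real"
  cost2 :: "'s \<Rightarrow> 'a \<Rightarrow> 'b \<Rightarrow> real"
  num_sub :: nat
  sub_cost :: "nat \<Rightarrow> 's \<Rightarrow> 'a \<Rightarrow> real"
  sub_bound :: "nat \<Rightarrow> real"
  num_con :: nat
  con_cost :: "nat \<Rightarrow> 's \<Rightarrow> 'a \<Rightarrow> 'b \<Rightarrow> real"
  con_bound :: "nat \<Rightarrow> real"
  trans_prob :: "'s \<Rightarrow> 'b \<Rightarrow> 's pmf"

definition wf_game :: "('s::finite, 'a, 'b) game \<Rightarrow> bool" where
  "wf_game G \<longleftrightarrow> (\<forall>s. finite (act1 G s) \<and> act1 G s \<noteq> {} \<and> finite (act2 G s) \<and> act2 G s \<noteq> {})"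

definition triples :: "('s, 'a, 'b) game \<Rightarrow> ('s \<times> 'a \<times> 'b) set" where
  "triples G = {(s, a, b). a \<in> act1 G s \<and> b \<in> act2 G s}"


section \<open>Strategies and the induced process\<close>

definition stationary1 :: "('s, 'a, 'b) game \<Rightarrow> ('s \<Rightarrow> 'a pmf) set" where
  "stationary1 G = {f. \<forall>s. set_pmf (f s) \<subseteq> act1 G s}"

definition stationary2 :: "('s, 'a, 'b) game \<Rightarrow> ('s \<Rightarrow> 'b pmf) set" where
  "stationary2 G = {g. \<forall>s. set_pmf (g s) \<subseteq> act2 G s}"

text \<open>
  A history \<open>(s\<^sub>0, a\<^sub>0, b\<^sub>0, \<dots>, s\<^sub>t)\<close> is given by the list of past triples, oldest first, and
  the current state.
\<close>

type_synonym ('s, 'a, 'b) strategy2 = "('s \<times> 'a \<times> 'b) list \<Rightarrow> 's \<Rightarrow> 'b pmf"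

definition history_dep2 :: "('s, 'a, 'b) game \<Rightarrow> ('s, 'a, 'b) strategy2 set" where
  "history_dep2 G = {\<sigma>. \<forall>h s. set h \<subseteq> triples G \<longrightarrow> set_pmf (\<sigma> h s) \<subseteq> act2 G s}"

definition of_stationary :: "('s \<Rightarrow> 'b pmf) \<Rightarrow> ('s, 'a, 'b) strategy2" where
  "of_stationary g = (\<lambda>h s. g s)"

text \<open>The law of the history up to time \<open>t\<close> under a stationary strategy of player 1 and a
  history-dependent strategy of player 2.\<close>

primrec history_law ::
  "('s, 'a, 'b) game \<Rightarrow> ('s \<Rightarrow> 'a pmf) \<Rightarrow> ('s, 'a, 'b) strategy2 \<Rightarrow> nat
    \<Rightarrow> (('s \<times> 'a \<times> 'b) list \<times> 's) pmf" where
  "history_law G f \<sigma> 0 = map_pmf (\<lambda>s. ([], s)) (init G)"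
| "history_law G f \<sigma> (Suc t) =
    bind_pmf (history_law G f \<sigma> t) (\<lambda>(h, s).
    bind_pmf (f s) (\<lambda>a.
    bind_pmf (\<sigma> h s) (\<lambda>b.
    map_pmf (\<lambda>s'. (h @ [(s, a, b)], s')) (trans_prob G s b))))"

text \<open>The law of the state and the two actions at time \<open>t\<close>.\<close>

definition stage_law ::
  "('s, 'a, 'b) game \<Rightarrow> ('s \<Rightarrow> 'a pmf) \<Rightarrow> ('s, 'a, 'b) strategy2 \<Rightarrow> nat
    \<Rightarrow> ('s \<times> 'a \<times> 'b) pmf" where
  "stage_law G f \<sigma> t =
    bind_pmf (history_law G f \<sigma> t) (\<lambda>(h, s).
    bind_pmf (f s) (\<lambda>a.
    map_pmf (\<lambda>b. (s, a, b)) (\<sigma> h s)))"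

definition average_cost ::
  "('s, 'a, 'b) game \<Rightarrow> ('s \<Rightarrow> 'a \<Rightarrow> 'b \<Rightarrow> real) \<Rightarrow> ('s \<Rightarrow> 'a pmf) \<Rightarrow> ('s, 'a, 'b) strategy2
    \<Rightarrow> ereal" where
  "average_cost G c f \<sigma> =
    limsup (\<lambda>T. ereal (1 / real T *
      (\<Sum>t<T. measure_pmf.expectation (stage_law G f \<sigma> t) (\<lambda>(s, a, b). c s a b))))"


section \<open>Feasibility and equilibria\<close>

definition feasible1 :: "('s::finite, 'a, 'b) game \<Rightarrow> ('s \<Rightarrow> 'a pmf) \<Rightarrow> bool" where
  "feasible1 G f \<longleftrightarrow>
    (\<forall>k\<in>{1..num_sub G}.
      (\<Sum>s\<in>UNIV. \<Sum>a\<in>act1 G s. sub_cost G k s a * pmf (f s) a) \<le> sub_bound G k)"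

definition feasible2 ::
  "('s::finite, 'a, 'b) game \<Rightarrow> ('s \<Rightarrow> 'a pmf) \<Rightarrow> ('s, 'a, 'b) strategy2 \<Rightarrow> bool" where
  "feasible2 G f \<sigma> \<longleftrightarrow>
    (\<forall>l\<in>{1..num_con G}. average_cost G (con_cost G l) f \<sigma> \<le> ereal (con_bound G l))"

definition nash_equilibrium ::
  "('s::finite, 'a, 'b) game \<Rightarrow> ('s \<Rightarrow> 'a pmf) \<Rightarrow> ('s \<Rightarrow> 'b pmf) \<Rightarrow> bool" where
  "nash_equilibrium G f g \<longleftrightarrow>
    f \<in> stationary1 G \<and> g \<in> stationary2 G \<and>
    feasible1 G f \<and> feasible2 G f (of_stationary g) \<and>
    (\<forall>f'\<in>stationary1 G. feasible1 G f' \<longrightarrow>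
      average_cost G (cost1 G) f (of_stationary g)
        \<le> average_cost G (cost1 G) f' (of_stationary g)) \<and>
    (\<forall>\<sigma>\<in>history_dep2 G. feasible2 G f \<sigma> \<longrightarrow>
      average_cost G (cost2 G) f (of_stationary g) \<le> average_cost G (cost2 G) f \<sigma>)"


section \<open>Standing assumptions\<close>

text \<open>\<open>first_passage P y n x\<close> is the probability that the chain with kernel \<open>P\<close> started in \<open>x\<close>
  visits \<open>y\<close> for the first time after time 0 exactly at time \<open>n + 1\<close>.\<close>

primrec first_passage :: "('s::finite \<Rightarrow> 's pmf) \<Rightarrow> 's \<Rightarrow> nat \<Rightarrow> 's \<Rightarrow> real" where
  "first_passage P y 0 x = pmf (P x) y"
| "first_passage P y (Suc n) x = (\<Sum>w\<in>UNIV - {y}. pmf (P x) w * first_passage P y n w)"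

definition recurrent :: "('s::finite \<Rightarrow> 's pmf) \<Rightarrow> 's \<Rightarrow> bool" where
  "recurrent P s \<longleftrightarrow> (\<lambda>n. first_passage P s n s) sums 1"

definition accessible :: "('s \<Rightarrow> 's pmf) \<Rightarrow> ('s \<times> 's) set" where
  "accessible P = {(s, s'). s' \<in> set_pmf (P s)}\<^sup>*"

definition recurrent_classes :: "('s::finite \<Rightarrow> 's pmf) \<Rightarrow> 's set set" where
  "recurrent_classes P =
    {{s'. (s, s') \<in> accessible P \<and> (s', s) \<in> accessible P} | s. recurrent P s}"

definition state_kernel :: "('s, 'a, 'b) game \<Rightarrow> ('s \<Rightarrow> 'b pmf) \<Rightarrow> 's \<Rightarrow> 's pmf" where
  "state_kernel G g s = bind_pmf (g s) (trans_prob G s)"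

definition unichain :: "('s::finite, 'a, 'b) game \<Rightarrow> bool" where
  "unichain G \<longleftrightarrow> (\<forall>g\<in>stationary2 G. \<exists>!C. C \<in> recurrent_classes (state_kernel G g))"

definition strong_slater :: "('s::finite, 'a, 'b) game \<Rightarrow> bool" where
  "strong_slater G \<longleftrightarrow>
    (\<exists>g\<in>stationary2 G. \<forall>f\<in>stationary1 G. \<forall>l\<in>{1..num_con G}.
      average_cost G (con_cost G l) f (of_stationary g) < ereal (con_bound G l))"


section \<open>The mathematical program\<close>

text \<open>Components outside the respective finite index sets do not enter the program.\<close>

record ('s, 'a, 'b) mp_point =
  mp_v :: real
  mp_u :: "'s \<Rightarrow> real"
  mp_z :: "'s \<Rightarrow> real"
  mp_f :: "'s \<Rightarrow> 'a \<Rightarrow> real"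
  mp_x :: "'s \<Rightarrow> 'b \<Rightarrow> real"
  mp_d1 :: "nat \<Rightarrow> real"
  mp_d2 :: "nat \<Rightarrow> real"

definition mp_objective :: "('s::finite, 'a, 'b) game \<Rightarrow> ('s, 'a, 'b) mp_point \<Rightarrow> real" where
  "mp_objective G \<eta> =
    ((\<Sum>s\<in>UNIV. \<Sum>a\<in>act1 G s. \<Sum>b\<in>act2 G s. mp_f \<eta> s a * cost1 G s a b * mp_x \<eta> s b)
      - ((\<Sum>s\<in>UNIV. mp_z \<eta> s) - (\<Sum>k = 1..num_sub G. mp_d1 \<eta> k * sub_bound G k)))
    + ((\<Sum>s\<in>UNIV. \<Sum>a\<in>act1 G s. \<Sum>b\<in>act2 G s. mp_f \<eta> s a * cost2 G s a b * mp_x \<eta> s b)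
      - (mp_v \<eta> - (\<Sum>l = 1..num_con G. mp_d2 \<eta> l * con_bound G l)))"

definition mp_feasible :: "('s::finite, 'a, 'b) game \<Rightarrow> ('s, 'a, 'b) mp_point \<Rightarrow> bool" where
  "mp_feasible G \<eta> \<longleftrightarrow>
    (\<forall>s. \<forall>b\<in>act2 G s.
      mp_v \<eta> + mp_u \<eta> s \<le>
        (\<Sum>a\<in>act1 G s. mp_f \<eta> s a * cost2 G s a b)
        + (\<Sum>l = 1..num_con G. mp_d2 \<eta> l * (\<Sum>a\<in>act1 G s. mp_f \<eta> s a * con_cost G l s a b))
        + (\<Sum>s'\<in>UNIV. pmf (trans_prob G s b) s' * mp_u \<eta> s')) \<and>
    (\<forall>s. \<forall>a\<in>act1 G s.
      mp_z \<eta> s \<le>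
        (\<Sum>b\<in>act2 G s. cost1 G s a b * mp_x \<eta> s b)
        + (\<Sum>k = 1..num_sub G. mp_d1 \<eta> k * sub_cost G k s a)) \<and>
    (\<forall>s'. (\<Sum>s\<in>UNIV. \<Sum>b\<in>act2 G s.
        ((if s = s' then 1 else 0) - pmf (trans_prob G s b) s') * mp_x \<eta> s b) = 0) \<and>
    (\<Sum>s\<in>UNIV. \<Sum>b\<in>act2 G s. mp_x \<eta> s b) = 1 \<and>
    (\<forall>k\<in>{1..num_sub G}.
      (\<Sum>s\<in>UNIV. \<Sum>a\<in>act1 G s. sub_cost G k s a * mp_f \<eta> s a) \<le> sub_bound G k) \<and>
    (\<forall>l\<in>{1..num_con G}.
      (\<Sum>s\<in>UNIV. \<Sum>a\<in>act1 G s. \<Sum>b\<in>act2 G s. mp_f \<eta> s a * con_cost G l s a b * mp_x \<eta> s b)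
        \<le> con_bound G l) \<and>
    (\<forall>s. (\<Sum>a\<in>act1 G s. mp_f \<eta> s a) = 1) \<and>
    (\<forall>s. \<forall>a\<in>act1 G s. mp_f \<eta> s a \<ge> 0) \<and>
    (\<forall>s. \<forall>b\<in>act2 G s. mp_x \<eta> s b \<ge> 0) \<and>
    (\<forall>k\<in>{1..num_sub G}. mp_d1 \<eta> k \<ge> 0) \<and>
    (\<forall>l\<in>{1..num_con G}. mp_d2 \<eta> l \<ge> 0)"

definition mp_global_min :: "('s::finite, 'a, 'b) game \<Rightarrow> ('s, 'a, 'b) mp_point \<Rightarrow> bool" where
  "mp_global_min G \<eta> \<longleftrightarrow>
    mp_feasible G \<eta> \<and> (\<forall>\<eta>'. mp_feasible G \<eta>' \<longrightarrow> mp_objective G \<eta> \<le> mp_objective G \<eta>')"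

text \<open>The strategy \<open>f\<close> has the given vector of probabilities; among the members of
  \<open>stationary1 G\<close> it is then unique.\<close>

definition has_weights1 ::
  "('s, 'a, 'b) game \<Rightarrow> ('s \<Rightarrow> 'a pmf) \<Rightarrow> ('s \<Rightarrow> 'a \<Rightarrow> real) \<Rightarrow> bool" where
  "has_weights1 G f w \<longleftrightarrow> (\<forall>s. \<forall>a\<in>act1 G s. pmf (f s) a = w s a)"

text \<open>\<open>g\<close> is a normalisation of \<open>x\<close>, arbitrary in the states where \<open>x\<close> has total mass 0.\<close>

definition normalises2 ::
  "('s, 'a, 'b) game \<Rightarrow> ('s \<Rightarrow> 'b pmf) \<Rightarrow> ('s \<Rightarrow> 'b \<Rightarrow> real) \<Rightarrow> bool" where
  "normalises2 G g x \<longleftrightarrow>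
    (\<forall>s. (\<Sum>b\<in>act2 G s. x s b) \<noteq> 0 \<longrightarrow>
      (\<forall>b\<in>act2 G s. pmf (g s) b = x s b / (\<Sum>b'\<in>act2 G s. x s b')))"

end

theory Submission
  imports Defs
begin

text \<open>
  Since player 2 alone controls the transitions, each player faces a linear program once the other
  player's stationary strategy is fixed.  Against \<open>g\<close>, the frequencies \<open>x\<close> of states and actions of
  player 2 do not depend on \<open>f\<close>, so player 1 minimises a linear function of \<open>f\<close> on a polytope.  Against
  \<open>f\<close>, player 2 minimises a linear function of the occupation measure \<open>x\<close>, subject to balance,
  normalisation and the cost constraints.  The mathematical program collects the primal and dual
  constraints of both linear programs, and its objective is the sum of the two duality gaps
  (\<open>mp_feasible_iff\<close>, \<open>mp_objective_eq\<close>).  So the objective is nonnegative by weak duality, and by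
  strong duality it can be made zero, for given \<open>f\<close> and \<open>x\<close>, exactly when these are optimal against
  each other.

  In a unichain game the occupation measures correspond to the stationary strategies, up to the choice
  of actions in states without mass, and average costs are the bilinear form at the occupation measure
  (\<open>average_cost_of_stationary\<close>).  This needs that the chain of \<open>g\<close> has only one stationary
  distribution, which follows from the uniqueness of the recurrent class because stationary measures
  live on recurrent states (\<open>stationary_measure_positive_recurrent\<close>).  The ergodic theorem is
  then obtained from linear programming duality (\<open>lp_strong_duality\<close>): a dual solution \<open>u\<close> is a
  potential whose increments telescope along the process (\<open>drift_lower_bound\<close>).

  An equilibrium gives a point with objective zero by strong duality for both players.  Conversely,
  at a point with objective zero, weak duality shows that player 1 has no profitable deviation.  For
  player 2, telescoping with the dual solution shows that no history-dependent feasible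
  strategy has a cost below the dual value (\<open>lagrangian_lower_bound\<close>).
\<close>

section \<open>Linear programming duality\<close>

text \<open>
  Farkas' lemma by Bartl's induction on the number of inequalities, which is purely algebraic and
  so avoids proving that finitely generated cones are closed.  If the inequality of row \<open>k\<close> is needed
  for the conclusion, some \<open>x0\<close> satisfies all other rows and violates the conclusion; then row \<open>k\<close>
  is negative at \<open>x0\<close>, and projecting along \<open>x0\<close> eliminates row \<open>k\<close>.
\<close>
lemma farkas:
  fixes A :: "'j \<Rightarrow> 'i \<Rightarrow> real" and c :: "'i \<Rightarrow> real"
  assumes "finite J" and "finite I"
    and "\<And>x. (\<And>j. j \<in> J \<Longrightarrow> (\<Sum>i\<in>I. A j i * x i) \<ge> 0) \<Longrightarrow> (\<Sum>i\<in>I. c i * x i) \<ge> 0"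
  shows "\<exists>y. (\<forall>j\<in>J. y j \<ge> 0) \<and> (\<forall>i\<in>I. c i = (\<Sum>j\<in>J. y j * A j i))"
  using assms(1,3)
proof (induction J arbitrary: A c rule: finite_induct)
  case empty
  have "c i = 0" if "i \<in> I" for i
  proof -
    have "(\<Sum>i'\<in>I. c i' * (if i' = i then - c i else 0)) \<ge> 0"
      by (rule empty) simp
    moreover have "(\<Sum>i'\<in>I. c i' * (if i' = i then - c i else 0)) = - (c i)\<^sup>2"
      using that assms(2) by (simp add: power2_eq_square if_distrib cong: if_cong)
    ultimately show ?thesis by simp
  qed
  then show ?case by simp
next
  case (insert k J)
  show ?case
  proof (cases "\<forall>x. (\<forall>j\<in>J. (\<Sum>i\<in>I. A j i * x i) \<ge> 0) \<longrightarrow> (\<Sum>i\<in>I. c i * x i) \<ge> 0")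
    case True
    then obtain y where y: "\<forall>j\<in>J. y j \<ge> 0" "\<forall>i\<in>I. c i = (\<Sum>j\<in>J. y j * A j i)"
      using insert.IH[of A c] by blast
    have "(\<Sum>j\<in>J. (if j = k then 0 else y j) * A j i) = (\<Sum>j\<in>J. y j * A j i)" for i
      using insert.hyps by (intro sum.cong) auto
    then show ?thesis
      using y insert.hyps by (intro exI[of _ "\<lambda>j. if j = k then 0 else y j"]) auto
  next
    case False
    then obtain x1 where x1: "\<forall>j\<in>J. (\<Sum>i\<in>I. A j i * x1 i) \<ge> 0" "(\<Sum>i\<in>I. c i * x1 i) < 0"
      by force
    let ?r = "- (\<Sum>i\<in>I. A k i * x1 i)"
    have r: "?r > 0"
      using insert.prems[of x1] x1 by force
    define x0 where "x0 = (\<lambda>i. x1 i / ?r)"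
    define a where "a = (\<lambda>j. \<Sum>i\<in>I. A j i * x0 i)"
    have scale: "(\<Sum>i\<in>I. d i * x0 i) = (\<Sum>i\<in>I. d i * x1 i) / ?r" for d
      unfolding x0_def by (simp add: sum_divide_distrib sum_negf)
    have a: "\<And>j. j \<in> J \<Longrightarrow> a j \<ge> 0" "a k = -1" "(\<Sum>i\<in>I. c i * x0 i) < 0"
      unfolding a_def scale using x1 r by (auto simp: divide_simps)
    define b where "b = (\<Sum>i\<in>I. c i * x0 i)"
    \<comment> \<open>Projecting along \<open>x0\<close> onto the hyperplane on which row \<open>k\<close> vanishes.\<close>
    have "\<exists>y. (\<forall>j\<in>J. y j \<ge> 0) \<and>
        (\<forall>i\<in>I. c i + b * A k i = (\<Sum>j\<in>J. y j * (A j i + a j * A k i)))"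
    proof (rule insert.IH)
      fix x assume pos: "\<And>j. j \<in> J \<Longrightarrow> (\<Sum>i\<in>I. (A j i + a j * A k i) * x i) \<ge> 0"
      define t where "t = (\<Sum>i\<in>I. A k i * x i)"
      have shift: "(\<Sum>i\<in>I. d i * (x i + t * x0 i)) = 
          (\<Sum>i\<in>I. (d i + (\<Sum>i\<in>I. d i * x0 i) * A k i) * x i)" for d
      proof -
        have "(\<Sum>i\<in>I. d i * (x i + t * x0 i)) = (\<Sum>i\<in>I. d i * x i) + (\<Sum>i\<in>I. d i * x0 i) * t"
          by (simp add: algebra_simps sum.distrib sum_distrib_left)
        then show ?thesis
          by (simp add: t_def algebra_simps sum.distrib sum_distrib_left)
      qed
      have "(\<Sum>i\<in>I. c i * (x i + t * x0 i)) \<ge> 0"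
      proof (rule insert.prems)
        fix j assume "j \<in> insert k J"
        then consider "j = k" | "j \<in> J" by auto
        then show "(\<Sum>i\<in>I. A j i * (x i + t * x0 i)) \<ge> 0"
        proof cases
          case 1
          then show ?thesis
            using a(2) unfolding shift a_def by simp
        next
          case 2
          then show ?thesis using pos[of j] unfolding shift a_def by simp
        qed
      qed
      then show "(\<Sum>i\<in>I. (c i + b * A k i) * x i) \<ge> 0"
        unfolding shift b_def .
    qed
    then obtain y where y: "\<forall>j\<in>J. y j \<ge> 0"
        "\<forall>i\<in>I. c i + b * A k i = (\<Sum>j\<in>J. y j * (A j i + a j * A k i))"
      by blast
    define yk where "yk = (\<Sum>j\<in>J. y j * a j) - b"
    have "yk \<ge> 0"
      using a y(1) sum_nonneg[of J "\<lambda>j. y j * a j"] unfolding yk_def b_def by fastforce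
    moreover have "c i = yk * A k i + (\<Sum>j\<in>J. y j * A j i)" if "i \<in> I" for i
    proof -
      have "(\<Sum>j\<in>J. y j * (A j i + a j * A k i)) =
          (\<Sum>j\<in>J. y j * A j i) + (\<Sum>j\<in>J. y j * a j) * A k i"
        by (simp add: algebra_simps sum.distrib sum_distrib_left)
      then show ?thesis using y(2) that by (auto simp: yk_def algebra_simps)
    qed
    moreover have "(\<Sum>j\<in>J. (if j = k then yk else y j) * A j i) = (\<Sum>j\<in>J. y j * A j i)" for i
      using insert.hyps by (intro sum.cong) auto
    ultimately show ?thesis
      using y(1) insert.hyps by (intro exI[of _ "\<lambda>j. if j = k then yk else y j"]) auto
  qed
qed

text \<open>
  The multipliers \<open>w\<close> of the equations are free: each equation is split into two inequalities, and
  \<open>w\<close> is the difference of their multipliers.  The multipliers of the sign conditions become the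
  slack of the conclusion.
\<close>
lemma farkas_mixed:
  fixes E :: "'j \<Rightarrow> 'i \<Rightarrow> real" and D :: "'k \<Rightarrow> 'i \<Rightarrow> real" and c :: "'i \<Rightarrow> real"
  assumes fin: "finite I" "finite J" "finite K"
    and imp: "\<And>x. \<lbrakk>\<And>i. i \<in> I \<Longrightarrow> x i \<ge> 0; \<And>j. j \<in> J \<Longrightarrow> (\<Sum>i\<in>I. E j i * x i) = 0;
      \<And>k. k \<in> K \<Longrightarrow> (\<Sum>i\<in>I. D k i * x i) \<le> 0\<rbrakk> \<Longrightarrow> (\<Sum>i\<in>I. c i * x i) \<ge> 0"
  shows "\<exists>w \<delta>. (\<forall>k\<in>K. \<delta> k \<ge> 0) \<and>
    (\<forall>i\<in>I. (\<Sum>j\<in>J. w j * E j i) \<le> c i + (\<Sum>k\<in>K. \<delta> k * D k i))"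
proof -
  define A :: "('i + 'j + 'j) + 'k \<Rightarrow> 'i \<Rightarrow> real" where
    "A = case_sum (case_sum (\<lambda>i' i. if i = i' then 1 else 0)
      (case_sum E (\<lambda>j i. - E j i))) (\<lambda>k i. - D k i)"
  let ?R = "(I <+> (J <+> J)) <+> K"
  have "\<exists>y. (\<forall>r\<in>?R. y r \<ge> 0) \<and> (\<forall>i\<in>I. c i = (\<Sum>r\<in>?R. y r * A r i))"
  proof (rule farkas)
    fix x assume pos: "\<And>r. r \<in> ?R \<Longrightarrow> (\<Sum>i\<in>I. A r i * x i) \<ge> 0"
    show "(\<Sum>i\<in>I. c i * x i) \<ge> 0"
    proof (rule imp)
      fix i assume "i \<in> I"
      moreover have "(\<Sum>i'\<in>I. A (Inl (Inl i)) i' * x i') = (if i \<in> I then x i else 0)"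
        using fin(1) by (simp add: A_def if_distrib if_distribR cong: if_cong)
      ultimately show "x i \<ge> 0" using pos[of "Inl (Inl i)"] by auto
    next
      fix j assume "j \<in> J"
      then have "Inl (Inr (Inl j)) \<in> ?R" "Inl (Inr (Inr j)) \<in> ?R"
        by (simp_all add: InlI InrI)
      from this[THEN pos] show "(\<Sum>i\<in>I. E j i * x i) = 0"
        by (simp add: A_def sum_negf)
    next
      fix k assume "k \<in> K"
      then show "(\<Sum>i\<in>I. D k i * x i) \<le> 0"
        using pos[of "Inr k"] by (auto simp: A_def sum_negf)
    qed
  qed (use fin in auto)
  then obtain y where y: "\<forall>r\<in>?R. y r \<ge> 0" "\<forall>i\<in>I. c i = (\<Sum>r\<in>?R. y r * A r i)"
    by blast
  define w where "w = (\<lambda>j. y (Inl (Inr (Inl j))) - y (Inl (Inr (Inr j))))"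
  have "(\<Sum>j\<in>J. w j * E j i) \<le> c i + (\<Sum>k\<in>K. y (Inr k) * D k i)" if "i \<in> I" for i
  proof -
    have "(\<Sum>i'\<in>I. y (Inl (Inl i')) * A (Inl (Inl i')) i) = (if i \<in> I then y (Inl (Inl i)) else 0)"
      using fin(1) by (simp add: A_def if_distrib if_distribR cong: if_cong)
    then have "c i = y (Inl (Inl i)) + (\<Sum>j\<in>J. w j * E j i) - (\<Sum>k\<in>K. y (Inr k) * D k i)"
      using that y(2) fin
      by (simp add: sum.Plus A_def w_def sum_negf sum_subtractf algebra_simps)
    then show ?thesis using y(1) that by auto
  qed
  then show ?thesis using y(1)
    by (intro exI[of _ w] exI[of _ "\<lambda>k. y (Inr k)"]) auto
qed

text \<open>
  Duality without a constraint qualification, by homogenisation: with an extra coordinate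
  \<open>t = y None\<close> scaling the right-hand sides, optimality of \<open>x\<close> says that \<open>c y - val t\<close> is
  nonnegative on the cone of the homogenised constraints, and Farkas' lemma turns this into an
  optimal dual point.  The reverse inequality between the two values is weak duality.
\<close>
lemma lp_strong_duality:
  fixes E :: "'j \<Rightarrow> 'i \<Rightarrow> real" and D :: "'k \<Rightarrow> 'i \<Rightarrow> real" and c :: "'i \<Rightarrow> real"
  assumes fin: "finite I" "finite J" "finite K"
    and feas: "\<And>i. i \<in> I \<Longrightarrow> x i \<ge> 0" "\<And>j. j \<in> J \<Longrightarrow> (\<Sum>i\<in>I. E j i * x i) = e j"
      "\<And>k. k \<in> K \<Longrightarrow> (\<Sum>i\<in>I. D k i * x i) \<le> d k"
    and opt: "\<And>x'. \<lbrakk>\<And>i. i \<in> I \<Longrightarrow> x' i \<ge> 0; \<And>j. j \<in> J \<Longrightarrow> (\<Sum>i\<in>I. E j i * x' i) = e j;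
      \<And>k. k \<in> K \<Longrightarrow> (\<Sum>i\<in>I. D k i * x' i) \<le> d k\<rbrakk>
      \<Longrightarrow> (\<Sum>i\<in>I. c i * x i) \<le> (\<Sum>i\<in>I. c i * x' i)"
  shows "\<exists>w \<delta>. (\<forall>k\<in>K. \<delta> k \<ge> 0) \<and>
    (\<forall>i\<in>I. (\<Sum>j\<in>J. w j * E j i) \<le> c i + (\<Sum>k\<in>K. \<delta> k * D k i)) \<and>
    (\<Sum>i\<in>I. c i * x i) \<le> (\<Sum>j\<in>J. w j * e j) - (\<Sum>k\<in>K. \<delta> k * d k)"
proof -
  define val where "val = (\<Sum>i\<in>I. c i * x i)"
  define c' where "c' = case_option (- val) c"
  define E' where "E' = (\<lambda>j. case_option (- e j) (E j))"
  define D' where "D' = (\<lambda>k. case_option (- d k) (D k))"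
  let ?I = "insert None (Some ` I)"
  have split: "(\<Sum>i\<in>?I. g i * y i) = g None * y None + (\<Sum>i\<in>I. g (Some i) * y (Some i))"
    for g y :: "'i option \<Rightarrow> real"
    using fin(1) by (simp add: sum.reindex)
  have "\<exists>w \<delta>. (\<forall>k\<in>K. \<delta> k \<ge> 0) \<and>
    (\<forall>i\<in>?I. (\<Sum>j\<in>J. w j * E' j i) \<le> c' i + (\<Sum>k\<in>K. \<delta> k * D' k i))"
  proof (rule farkas_mixed)
    fix y :: "'i option \<Rightarrow> real"
    assume pos: "\<And>i. i \<in> ?I \<Longrightarrow> y i \<ge> 0"
      and eq: "\<And>j. j \<in> J \<Longrightarrow> (\<Sum>i\<in>?I. E' j i * y i) = 0"
      and le: "\<And>k. k \<in> K \<Longrightarrow> (\<Sum>i\<in>?I. D' k i * y i) \<le> 0"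
    define t where "t = y None"
    have eq': "(\<Sum>i\<in>I. E j i * y (Some i)) = e j * t" if "j \<in> J" for j
      using eq[OF that] unfolding split by (simp add: E'_def t_def)
    have le': "(\<Sum>i\<in>I. D k i * y (Some i)) \<le> d k * t" if "k \<in> K" for k
      using le[OF that] unfolding split by (simp add: D'_def t_def)
    have t: "t \<ge> 0" using pos by (simp add: t_def)
    \<comment> \<open>This point is feasible also for \<open>t = 0\<close>, when \<open>y\<close> is a direction of recession.\<close>
    define x' where "x' = (\<lambda>i. (x i + y (Some i)) / (1 + t))"
    have x': "(\<Sum>i\<in>I. g i * x' i) = ((\<Sum>i\<in>I. g i * x i) + (\<Sum>i\<in>I. g i * y (Some i))) / (1 + t)" for g
      by (simp add: x'_def sum_divide_distrib sum.distrib[symmetric] algebra_simps)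
    have "val \<le> (\<Sum>i\<in>I. c i * x' i)"
      unfolding val_def
    proof (rule opt)
      show "x' i \<ge> 0" if "i \<in> I" for i
        using that t pos feas(1)[OF that] by (auto simp: x'_def)
      show "(\<Sum>i\<in>I. E j i * x' i) = e j" if "j \<in> J" for j
        unfolding x' using t eq'[OF that] feas(2)[OF that] by (simp add: field_simps)
      show "(\<Sum>i\<in>I. D k i * x' i) \<le> d k" if "k \<in> K" for k
        unfolding x' using t le'[OF that] feas(3)[OF that] by (simp add: field_simps)
    qed
    then show "(\<Sum>i\<in>?I. c' i * y i) \<ge> 0"
      unfolding x' split c'_def using t by (simp add: val_def[symmetric] t_def[symmetric] field_simps)
  qed (use fin in auto)
  then obtain w \<delta> where w: "\<forall>k\<in>K. \<delta> k \<ge> 0"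
    "\<forall>i\<in>?I. (\<Sum>j\<in>J. w j * E' j i) \<le> c' i + (\<Sum>k\<in>K. \<delta> k * D' k i)"
    by blast
  have "(\<Sum>j\<in>J. w j * E j i) \<le> c i + (\<Sum>k\<in>K. \<delta> k * D k i)" if "i \<in> I" for i
    using w(2)[rule_format, of "Some i"] that by (simp add: E'_def D'_def c'_def)
  moreover have "val \<le> (\<Sum>j\<in>J. w j * e j) - (\<Sum>k\<in>K. \<delta> k * d k)"
    using w(2)[rule_format, of None] by (simp add: E'_def D'_def c'_def sum_negf)
  ultimately show ?thesis using w(1) unfolding val_def by blast
qed

section \<open>Stationary distributions of finite chains\<close>

lemma sum_kronecker_minus:
  fixes x q :: "'s::finite \<Rightarrow> real"
  shows "(\<Sum>s\<in>UNIV. ((if s = s0 then 1 else 0) - q s) * x s) = x s0 - (\<Sum>s\<in>UNIV. x s * q s)"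
    and "(\<Sum>s\<in>UNIV. x s * ((if s0 = s then 1 else 0) - q s)) = x s0 - (\<Sum>s\<in>UNIV. q s * x s)"
proof -
  have "x s * ((if s0 = s then 1 else 0) - q s) = (if s0 = s then x s else 0) - q s * x s" for s
    by (simp add: algebra_simps)
  then show *: "(\<Sum>s\<in>UNIV. x s * ((if s0 = s then 1 else 0) - q s)) = x s0 - (\<Sum>s\<in>UNIV. q s * x s)"
    by (simp add: sum_subtractf)
  then show "(\<Sum>s\<in>UNIV. ((if s = s0 then 1 else 0) - q s) * x s) = x s0 - (\<Sum>s\<in>UNIV. x s * q s)"
    by (simp add: mult.commute eq_commute)
qed

definition stationary_measure :: "('s::finite \<Rightarrow> 's pmf) \<Rightarrow> ('s \<Rightarrow> real) \<Rightarrow> bool" where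
  "stationary_measure P m \<longleftrightarrow>
    (\<forall>s. m s \<ge> 0) \<and> (\<forall>s'. (\<Sum>s\<in>UNIV. m s * pmf (P s) s') = m s')"

text \<open>
  Poincare recurrence.  Let \<open>q n x\<close> be the probability of not visiting \<open>s\<close> at the times \<open>1, ..., n\<close>
  when starting in \<open>x\<close>.  By stationarity, the mass \<open>a n\<close> of \<open>q n\<close> under \<open>m\<close> drops in each step by
  exactly \<open>m s * q n s\<close>.  These drops are therefore summable, so \<open>q n s\<close> tends to 0 when \<open>m s > 0\<close>.
\<close>
lemma stationary_measure_positive_recurrent:
  fixes P :: "'s::finite \<Rightarrow> 's pmf"
  assumes "stationary_measure P m" and "m s > 0"
  shows "recurrent P s"
proof -
  have m: "\<And>s. m s \<ge> 0" "\<And>s'. (\<Sum>s\<in>UNIV. m s * pmf (P s) s') = m s'"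
    using assms(1) by (auto simp: stationary_measure_def)
  define q where "q = (\<lambda>n x. 1 - (\<Sum>k<n. first_passage P s k x))"
  have q_Suc: "q (Suc n) x = (\<Sum>w\<in>UNIV - {s}. pmf (P x) w * q n w)" for n x
  proof -
    have "1 = (\<Sum>w\<in>UNIV. pmf (P x) w)"
      by (simp add: sum_pmf_eq_1)
    also have "\<dots> = pmf (P x) s + (\<Sum>w\<in>UNIV - {s}. pmf (P x) w)"
      by (simp add: sum.remove)
    finally have "1 - pmf (P x) s = (\<Sum>w\<in>UNIV - {s}. pmf (P x) w)" by simp
    moreover have "(\<Sum>k<n. \<Sum>w\<in>UNIV - {s}. pmf (P x) w * first_passage P s k w) =
        (\<Sum>w\<in>UNIV - {s}. pmf (P x) w * (\<Sum>k<n. first_passage P s k w))"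
      by (subst sum.swap) (simp add: sum_distrib_left)
    ultimately show ?thesis
      by (simp add: q_def sum.lessThan_Suc_shift right_diff_distrib sum_subtractf del: sum.lessThan_Suc)
  qed
  have q_nonneg: "q n x \<ge> 0" for n x
  proof (induction n arbitrary: x)
    case 0
    show ?case by (simp add: q_def)
  next
    case (Suc n)
    then show ?case unfolding q_Suc by (intro sum_nonneg) auto
  qed
  define a where "a = (\<lambda>n. \<Sum>x\<in>UNIV. m x * q n x)"
  have a_Suc: "a n - a (Suc n) = m s * q n s" for n
  proof -
    have "a (Suc n) = (\<Sum>w\<in>UNIV - {s}. (\<Sum>x\<in>UNIV. m x * pmf (P x) w) * q n w)"
      unfolding a_def q_Suc by (simp add: sum_distrib_left sum_distrib_right mult.assoc) (rule sum.swap)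
    also have "\<dots> = a n - m s * q n s"
      unfolding m(2) a_def by (simp add: sum.remove[of UNIV s])
    finally show ?thesis by simp
  qed
  have "(\<Sum>k<n. m s * q k s) \<le> a 0" for n
  proof -
    have "(\<Sum>k<n. m s * q k s) = a 0 - a n"
      by (induction n) (auto simp: a_Suc[symmetric])
    moreover have "a n \<ge> 0" unfolding a_def using m(1) q_nonneg by (intro sum_nonneg) auto
    ultimately show ?thesis by simp
  qed
  then have "summable (\<lambda>k. m s * q k s)"
    using assms(2) q_nonneg by (intro summableI_nonneg_bounded) auto
  then have "(\<lambda>k. m s * q k s / m s) \<longlonglongrightarrow> 0 / m s"
    by (intro tendsto_divide summable_LIMSEQ_zero) (use assms(2) in auto)
  then have "(\<lambda>k. 1 - q k s) \<longlonglongrightarrow> 1 - 0"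
    using assms(2) by (intro tendsto_diff) auto
  then show ?thesis
    by (simp add: recurrent_def sums_def q_def)
qed

lemma stationary_measure_positive_accessible:
  fixes P :: "'s::finite \<Rightarrow> 's pmf"
  assumes "stationary_measure P m" and "(s, s') \<in> accessible P" and "m s > 0"
  shows "m s' > 0"
  using assms(2,3) unfolding accessible_def
proof (induction rule: rtrancl_induct)
  case (step y z)
  have m: "\<And>s. m s \<ge> 0" "(\<Sum>s\<in>UNIV. m s * pmf (P s) z) = m z"
    using assms(1) by (auto simp: stationary_measure_def)
  have "0 < m y * pmf (P y) z"
    using step by (simp add: pmf_positive)
  also have "\<dots> \<le> (\<Sum>s\<in>UNIV. m s * pmf (P s) z)"
    using m(1) by (intro member_le_sum) auto
  finally show ?case using m(2) by simp
qed

text \<open>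
  The support of a stationary measure consists of recurrent states, which all communicate, and is
  closed under accessibility.  Hence a stationary measure that vanishes at a point of the support of
  another one vanishes identically; this is applied to \<open>m\<close> minus a multiple of \<open>m'\<close>.
\<close>
lemma stationary_distribution_unique:
  fixes P :: "'s::finite \<Rightarrow> 's pmf"
  assumes uni: "\<exists>!C. C \<in> recurrent_classes P"
    and m: "stationary_measure P m" "(\<Sum>s\<in>UNIV. m s) = 1"
    and m': "stationary_measure P m'" "(\<Sum>s\<in>UNIV. m' s) = 1"
  shows "m = m'"
proof -
  have communicate: "(s, s') \<in> accessible P" if "recurrent P s" "recurrent P s'" for s s'
  proof -
    let ?C = "\<lambda>s. {s'. (s, s') \<in> accessible P \<and> (s', s) \<in> accessible P}"
    have "?C s \<in> recurrent_classes P" "?C s' \<in> recurrent_classes P"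
      using that by (auto simp: recurrent_classes_def)
    then have "?C s = ?C s'" using uni by blast
    moreover have "s' \<in> ?C s'" by (auto simp: accessible_def)
    ultimately have "s' \<in> ?C s" by simp
    then show ?thesis by simp
  qed
  have nonneg: "\<And>s. m s \<ge> 0" "\<And>s. m' s \<ge> 0"
    using m m' by (auto simp: stationary_measure_def)
  let ?S = "{s. m' s > 0}"
  have "?S \<noteq> {}"
  proof
    assume "?S = {}"
    then have "m' s = 0" for s using nonneg(2)[of s] by (auto simp: order_less_le)
    then show False using m'(2) by simp
  qed
  \<comment> \<open>The largest multiple of \<open>m'\<close> below \<open>m\<close> touches \<open>m\<close> at some \<open>s0\<close>.\<close>
  define t where "t = Min ((\<lambda>s. m s / m' s) ` ?S)"
  have "t \<in> (\<lambda>s. m s / m' s) ` ?S"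
    unfolding t_def using \<open>?S \<noteq> {}\<close> by (intro Min_in) auto
  then obtain s0 where s0: "m' s0 > 0" "t = m s0 / m' s0" by auto
  define \<nu> where "\<nu> = (\<lambda>s. m s - t * m' s)"
  have \<nu>_nonneg: "\<nu> s \<ge> 0" for s
  proof (cases "m' s > 0")
    case True
    then have "t \<le> m s / m' s" unfolding t_def by (intro Min_le) auto
    then show ?thesis using True by (simp add: \<nu>_def field_simps)
  next
    case False
    then have "m' s = 0" using nonneg(2)[of s] by simp
    then show ?thesis using nonneg(1) by (simp add: \<nu>_def)
  qed
  have \<nu>: "stationary_measure P \<nu>"
  proof -
    have "(\<Sum>s\<in>UNIV. \<nu> s * pmf (P s) s') =
        (\<Sum>s\<in>UNIV. m s * pmf (P s) s') - t * (\<Sum>s\<in>UNIV. m' s * pmf (P s) s')" for s'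
      by (simp add: \<nu>_def algebra_simps sum_subtractf sum_distrib_left)
    then show ?thesis
      using m(1) m'(1) \<nu>_nonneg by (auto simp: stationary_measure_def \<nu>_def)
  qed
  have "\<nu> s = 0" for s
  proof (rule ccontr)
    assume "\<nu> s \<noteq> 0"
    then have "\<nu> s > 0" using \<nu>_nonneg[of s] by simp
    then have "\<nu> s0 > 0"
      using communicate stationary_measure_positive_recurrent[OF \<nu>]
        stationary_measure_positive_recurrent[OF m'(1) s0(1)]
        stationary_measure_positive_accessible[OF \<nu>] by blast
    then show False using s0 by (simp add: \<nu>_def)
  qed
  then have eq: "m s = t * m' s" for s by (simp add: \<nu>_def)
  then have "t = 1" using m(2) m'(2) by (simp add: sum_distrib_left[symmetric])
  then show ?thesis using eq by auto
qed

text \<open>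
  Otherwise 0 would be the maximal total mass of a stationary measure of mass at most 1.  A dual
  optimum for this linear program is a function \<open>w\<close> with \<open>w s \<le> (\<Sum>s'. P s s' * w s') - 1\<close> everywhere,
  which fails where \<open>w\<close> is maximal.
\<close>
lemma stationary_distribution_exists:
  fixes P :: "'s::finite \<Rightarrow> 's pmf"
  shows "\<exists>m. stationary_measure P m \<and> (\<Sum>s\<in>UNIV. m s) = 1"
proof (rule ccontr)
  assume none: "\<nexists>m. stationary_measure P m \<and> (\<Sum>s\<in>UNIV. m s) = 1"
  define E where "E = (\<lambda>s' s. (if s = s' then 1 else 0) - pmf (P s) s')"
  have "\<exists>w \<delta>. (\<forall>k\<in>{()}. \<delta> k \<ge> 0) \<and>
    (\<forall>s\<in>UNIV. (\<Sum>s'\<in>UNIV. w s' * E s' s) \<le> - 1 + (\<Sum>k\<in>{()}. \<delta> k * 1)) \<and>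
    (\<Sum>s\<in>(UNIV :: 's set). - 1 * 0) \<le> (\<Sum>s'\<in>(UNIV :: 's set). w s' * 0) - (\<Sum>k\<in>{()}. \<delta> k * 1)"
  proof (rule lp_strong_duality[where c = "\<lambda>s. - 1" and x = "\<lambda>s. 0" and E = E and D = "\<lambda>k s. 1" and e = "\<lambda>s. 0" and d = "\<lambda>k. 1"])
    fix x assume x: "\<And>s. s \<in> UNIV \<Longrightarrow> x s \<ge> 0"
      "\<And>s'. s' \<in> UNIV \<Longrightarrow> (\<Sum>s\<in>UNIV. E s' s * x s) = 0"
    have stat: "(\<Sum>s\<in>UNIV. x s * pmf (P s) s') = x s'" for s'
      using x(2)[of s'] by (simp add: E_def sum_kronecker_minus)
    have "(\<Sum>s\<in>UNIV. x s) = 0"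
    proof (rule ccontr)
      let ?N = "\<Sum>s\<in>UNIV. x s"
      assume "?N \<noteq> 0"
      moreover have "?N \<ge> 0" using x(1) by (simp add: sum_nonneg)
      ultimately have "stationary_measure P (\<lambda>s. x s / ?N) \<and> (\<Sum>s\<in>UNIV. x s / ?N) = 1"
        using x(1) stat
        by (auto simp: stationary_measure_def sum_divide_distrib[symmetric])
      then show False using none by blast
    qed
    then show "(\<Sum>s\<in>UNIV. - 1 * 0) \<le> (\<Sum>s\<in>UNIV. - 1 * x s)"
      by (simp add: sum_negf)
  qed auto
  then obtain w \<delta> where w: "\<And>s. (\<Sum>s'\<in>UNIV. w s' * E s' s) \<le> - 1 + \<delta> ()" "\<delta> () \<le> (0::real)"
    by auto
  have wE: "(\<Sum>s'\<in>UNIV. w s' * E s' s) = w s - (\<Sum>s'\<in>UNIV. pmf (P s) s' * w s')" for s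
    by (simp add: E_def sum_kronecker_minus)
  have "Max (range w) \<in> range w" by (intro Max_in) auto
  then obtain s where s: "w s = Max (range w)" by (metis rangeE)
  have "(\<Sum>s'\<in>UNIV. pmf (P s) s' * w s') \<le> (\<Sum>s'\<in>UNIV. pmf (P s) s' * w s)"
    unfolding s by (intro sum_mono mult_left_mono) auto
  also have "\<dots> = w s"
    by (simp add: sum_distrib_right[symmetric] sum_pmf_eq_1)
  finally show False using w(1)[of s] w(2) unfolding wE by simp
qed

lemma sum_option:
  fixes g :: "'s::finite option \<Rightarrow> real"
  shows "(\<Sum>j\<in>UNIV. g j) = g None + (\<Sum>s\<in>UNIV. g (Some s))"
  by (simp add: UNIV_option_conv sum.reindex)

text \<open>
  Half of the Poisson equation.  As \<open>m\<close> is the only feasible point, it trivially minimises the mean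
  of \<open>c\<close> over the stationary distributions; \<open>u\<close> consists of the dual variables of the balance
  equations, and the dual variable of the normalisation is at least the optimal value.  Such
  potentials, for \<open>c\<close> and for \<open>-c\<close>, determine the limit of Cesaro averages by telescoping.
\<close>
lemma potential_exists:
  fixes P :: "'s::finite \<Rightarrow> 's pmf"
  assumes uni: "\<exists>!C. C \<in> recurrent_classes P"
    and m: "stationary_measure P m" "(\<Sum>s\<in>UNIV. m s) = 1"
  shows "\<exists>u. \<forall>s. (\<Sum>s\<in>UNIV. c s * m s) + u s \<le> c s + (\<Sum>s'\<in>UNIV. pmf (P s) s' * u s')"
proof -
  define E where "E = case_option (\<lambda>s. 1) (\<lambda>s' s. (if s = s' then 1 else 0) - pmf (P s) s')"
  define e :: "'s option \<Rightarrow> real" where "e = case_option 1 (\<lambda>s. 0)"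
  have stat: "(\<Sum>s\<in>UNIV. E (Some s') s * x s) = x s' - (\<Sum>s\<in>UNIV. x s * pmf (P s) s')" for x s'
    by (simp add: E_def sum_kronecker_minus)
  have "\<exists>w \<delta>. (\<forall>k\<in>{}::unit set. \<delta> k \<ge> 0) \<and>
    (\<forall>s\<in>UNIV. (\<Sum>j\<in>UNIV. w j * E j s) \<le> c s + (\<Sum>k\<in>{}. \<delta> k * 0)) \<and>
    (\<Sum>s\<in>UNIV. c s * m s) \<le> (\<Sum>j\<in>UNIV. w j * e j) - (\<Sum>k\<in>{}. \<delta> k * 0)"
  proof (rule lp_strong_duality[where x = m and E = E and D = "\<lambda>k s. 0" and e = e and d = "\<lambda>k. 0"])
    show "(\<Sum>s\<in>UNIV. E j s * m s) = e j" for j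
      using m by (cases j) (simp_all only: stat, auto simp: E_def e_def stationary_measure_def)
  next
    fix x assume x: "\<And>s. s \<in> UNIV \<Longrightarrow> x s \<ge> 0"
      "\<And>j. j \<in> UNIV \<Longrightarrow> (\<Sum>s\<in>UNIV. E j s * x s) = e j"
    have "stationary_measure P x"
      unfolding stationary_measure_def
    proof (intro conjI allI)
      show "(\<Sum>s\<in>UNIV. x s * pmf (P s) s') = x s'" for s'
        using x(2)[of "Some s'"] unfolding stat by (simp add: e_def)
    qed (use x(1) in simp)
    moreover have "(\<Sum>s\<in>UNIV. x s) = 1"
      using x(2)[of None] by (simp add: E_def e_def)
    ultimately have "x = m" using stationary_distribution_unique[OF uni] m by blast
    then show "(\<Sum>s\<in>UNIV. c s * m s) \<le> (\<Sum>s\<in>UNIV. c s * x s)" by simp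
  qed (use m in \<open>simp_all add: stationary_measure_def\<close>)
  moreover have "(\<Sum>j\<in>UNIV. w j * e j) = w None" for w
    by (simp add: sum_option e_def)
  ultimately obtain w where w: "\<And>s. (\<Sum>j\<in>UNIV. w j * E j s) \<le> c s"
    "(\<Sum>s\<in>UNIV. c s * m s) \<le> w None"
    by auto
  have "(\<Sum>j\<in>UNIV. w j * E j s) = w None + w (Some s) - (\<Sum>s'\<in>UNIV. pmf (P s) s' * w (Some s'))" for s
    unfolding sum_option by (simp add: E_def sum_kronecker_minus)
  then have "(\<Sum>s\<in>UNIV. c s * m s) + w (Some s) \<le> c s + (\<Sum>s'\<in>UNIV. pmf (P s) s' * w (Some s'))" for s
    using w(1)[of s] w(2) by simp
  then show ?thesis by (intro exI[of _ "\<lambda>s. w (Some s)"]) simp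
qed

section \<open>Expected costs along histories\<close>

text \<open>
  A strategy of player 2 is constrained only at admissible histories, so that expectations are finite
  sums rests on the law of the history living on these.
\<close>
lemma history_law_support:
  assumes "wf_game G" and "f \<in> stationary1 G" and "\<sigma> \<in> history_dep2 G"
  shows "finite (set_pmf (history_law G f \<sigma> t))"
    and "(h, s) \<in> set_pmf (history_law G f \<sigma> t) \<Longrightarrow> set h \<subseteq> triples G"
proof -
  have fin: "finite (act1 G s)" "finite (act2 G s)" for s
    using assms(1) by (auto simp: wf_game_def)
  have f: "set_pmf (f s) \<subseteq> act1 G s" for s
    using assms(2) by (auto simp: stationary1_def)
  have \<sigma>: "set_pmf (\<sigma> h s) \<subseteq> act2 G s" if "set h \<subseteq> triples G" for h s
    using assms(3) that by (auto simp: history_dep2_def)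
  have "finite (set_pmf (history_law G f \<sigma> t)) \<and>
      (\<forall>(h, s)\<in>set_pmf (history_law G f \<sigma> t). set h \<subseteq> triples G)"
  proof (induction t)
    case 0
    then show ?case by auto
  next
    case (Suc t)
    have "finite (set_pmf (\<sigma> h s))" if "(h, s) \<in> set_pmf (history_law G f \<sigma> t)" for h s
      using Suc \<sigma>[of h s] that fin finite_subset by blast
    moreover have "finite (set_pmf (f s))" for s
      using f fin finite_subset by blast
    ultimately have "finite (set_pmf (history_law G f \<sigma> (Suc t)))"
      using Suc by auto
    moreover have "set h' \<subseteq> triples G" if "(h', s') \<in> set_pmf (history_law G f \<sigma> (Suc t))" for h' s'
    proof -
      obtain h s a b where "(h, s) \<in> set_pmf (history_law G f \<sigma> t)" "a \<in> set_pmf (f s)"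
        "b \<in> set_pmf (\<sigma> h s)" "h' = h @ [(s, a, b)]"
        using \<open>(h', s') \<in> set_pmf (history_law G f \<sigma> (Suc t))\<close> by auto
      moreover from this have "set h \<subseteq> triples G" using Suc by auto
      ultimately show ?thesis
        using f[of s] \<sigma>[of h s] by (auto simp: triples_def)
    qed
    ultimately show ?case by (auto simp del: history_law.simps)
  qed
  then show "finite (set_pmf (history_law G f \<sigma> t))"
    and "(h, s) \<in> set_pmf (history_law G f \<sigma> t) \<Longrightarrow> set h \<subseteq> triples G"
    by auto
qed

definition expected_stage_cost where
  "expected_stage_cost G c f \<sigma> t =
    measure_pmf.expectation (stage_law G f \<sigma> t) (\<lambda>(s, a, b). c s a b)"

definition expected_potential where
  "expected_potential G u f \<sigma> t =
    measure_pmf.expectation (history_law G f \<sigma> t) (\<lambda>(h, s). u s)"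

definition mean_cost ::
  "('s, 'a, 'b) game \<Rightarrow> ('s \<Rightarrow> 'a \<Rightarrow> 'b \<Rightarrow> real) \<Rightarrow> ('s \<Rightarrow> 'a \<Rightarrow> real) \<Rightarrow> 's \<Rightarrow> 'b \<Rightarrow> real" where
  "mean_cost G c f s b = (\<Sum>a\<in>act1 G s. f s a * c s a b)"

text \<open>
  The common form of the stage law and of the one-step law of the history; \<open>N\<close> is what follows the
  choice of the two actions.
\<close>
lemma expectation_bind_history:
  fixes F :: "_ \<Rightarrow> real"
  assumes "wf_game G" and "f \<in> stationary1 G" and "\<sigma> \<in> history_dep2 G"
    and "\<And>h s a b. \<lbrakk>set h \<subseteq> triples G; a \<in> act1 G s; b \<in> act2 G s\<rbrakk> \<Longrightarrow> finite (set_pmf (N h s a b))"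
  shows "measure_pmf.expectation (bind_pmf (history_law G f \<sigma> t) (\<lambda>(h, s).
      bind_pmf (f s) (\<lambda>a. bind_pmf (\<sigma> h s) (\<lambda>b. N h s a b)))) F =
    (\<Sum>(h, s)\<in>set_pmf (history_law G f \<sigma> t). pmf (history_law G f \<sigma> t) (h, s) *
      (\<Sum>b\<in>act2 G s. pmf (\<sigma> h s) b * (\<Sum>a\<in>act1 G s. pmf (f s) a *
        measure_pmf.expectation (N h s a b) F)))"
proof -
  let ?H = "set_pmf (history_law G f \<sigma> t)"
  have fin: "finite (act1 G s)" "finite (act2 G s)" for s
    using assms(1) by (auto simp: wf_game_def)
  have f: "set_pmf (f s) \<subseteq> act1 G s" for s
    using assms(2) by (auto simp: stationary1_def)
  have \<sigma>: "set_pmf (\<sigma> h s) \<subseteq> act2 G s" if "set h \<subseteq> triples G" for h s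
    using assms(3) that by (auto simp: history_dep2_def)
  note H = history_law_support[OF assms(1-3)]
  have inner_fin: "finite (set_pmf (bind_pmf (\<sigma> h s) (\<lambda>b. N h s a b)))"
    if "set h \<subseteq> triples G" "a \<in> act1 G s" for h s a
    using \<sigma>[OF that(1), of s] assms(4)[OF that] fin(2)[of s] finite_subset[OF \<sigma>[OF that(1), of s]]
    by auto
  have inner: "measure_pmf.expectation (bind_pmf (f s) (\<lambda>a. bind_pmf (\<sigma> h s) (\<lambda>b. N h s a b))) F =
    (\<Sum>b\<in>act2 G s. pmf (\<sigma> h s) b * (\<Sum>a\<in>act1 G s. pmf (f s) a * measure_pmf.expectation (N h s a b) F))"
    if h: "set h \<subseteq> triples G" for h s
  proof -
    have "measure_pmf.expectation (bind_pmf (f s) (\<lambda>a. bind_pmf (\<sigma> h s) (\<lambda>b. N h s a b))) F =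
      (\<Sum>a\<in>act1 G s. pmf (f s) a * measure_pmf.expectation (bind_pmf (\<sigma> h s) (\<lambda>b. N h s a b)) F)"
      using pmf_expectation_bind[of "act1 G s" "\<lambda>a. bind_pmf (\<sigma> h s) (\<lambda>b. N h s a b)" "f s" F]
        fin f[of s] inner_fin[OF h] by simp
    also have "\<dots> = (\<Sum>a\<in>act1 G s. pmf (f s) a *
        (\<Sum>b\<in>act2 G s. pmf (\<sigma> h s) b * measure_pmf.expectation (N h s a b) F))"
      using pmf_expectation_bind[of "act2 G s" _ "\<sigma> h s" F] fin \<sigma>[OF h, of s] assms(4)[OF h]
      by (intro sum.cong) auto
    also have "\<dots> = (\<Sum>b\<in>act2 G s. pmf (\<sigma> h s) b *
        (\<Sum>a\<in>act1 G s. pmf (f s) a * measure_pmf.expectation (N h s a b) F))"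
      by (simp add: sum_distrib_left algebra_simps) (rule sum.swap)
    finally show ?thesis .
  qed
  have finf: "finite (set_pmf (f s))" for s
    using f fin finite_subset by blast
  have "finite (set_pmf (case hs of (h, s) \<Rightarrow>
      bind_pmf (f s) (\<lambda>a. bind_pmf (\<sigma> h s) (\<lambda>b. N h s a b))))" if "hs \<in> ?H" for hs
  proof (cases hs)
    case (Pair h s)
    have "finite (set_pmf (bind_pmf (\<sigma> h s) (\<lambda>b. N h s a b)))" if "a \<in> set_pmf (f s)" for a
      using inner_fin[of h a s] H(2)[of h s] \<open>hs \<in> ?H\<close> f[of s] that Pair by blast
    then show ?thesis
      using finf unfolding Pair by simp
  qed
  then show ?thesis
    using H by (subst pmf_expectation_bind[of ?H]) (auto intro!: sum.cong simp: inner)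
qed

lemma expectation_history:
  fixes F :: "_ \<Rightarrow> real"
  assumes "wf_game G" and "f \<in> stationary1 G" and "\<sigma> \<in> history_dep2 G"
  shows "measure_pmf.expectation (history_law G f \<sigma> t) F =
    (\<Sum>hs\<in>set_pmf (history_law G f \<sigma> t). pmf (history_law G f \<sigma> t) hs * F hs)"
  using history_law_support(1)[OF assms, of t] by (subst integral_measure_pmf) auto

lemma expected_stage_cost_history:
  assumes "wf_game G" and "f \<in> stationary1 G" and "\<sigma> \<in> history_dep2 G"
  shows "expected_stage_cost G c f \<sigma> t =
    (\<Sum>(h, s)\<in>set_pmf (history_law G f \<sigma> t). pmf (history_law G f \<sigma> t) (h, s) *
      (\<Sum>b\<in>act2 G s. pmf (\<sigma> h s) b * mean_cost G c (\<lambda>s. pmf (f s)) s b))"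
  unfolding expected_stage_cost_def stage_law_def map_pmf_def mean_cost_def
  by (subst expectation_bind_history[OF assms]) simp_all

lemma expected_potential_Suc:
  fixes G :: "('s::finite, 'a, 'b) game"
  assumes "wf_game G" and "f \<in> stationary1 G" and "\<sigma> \<in> history_dep2 G"
  shows "expected_potential G u f \<sigma> (Suc t) =
    (\<Sum>(h, s)\<in>set_pmf (history_law G f \<sigma> t). pmf (history_law G f \<sigma> t) (h, s) *
      (\<Sum>b\<in>act2 G s. pmf (\<sigma> h s) b * (\<Sum>s'\<in>UNIV. pmf (trans_prob G s b) s' * u s')))"
proof -
  have f: "(\<Sum>a\<in>act1 G s. pmf (f s) a) = 1" for s
    using assms(1,2) by (intro sum_pmf_eq_1) (auto simp: wf_game_def stationary1_def)
  have "measure_pmf.expectation (trans_prob G s b) u =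
      (\<Sum>s'\<in>UNIV. pmf (trans_prob G s b) s' * u s')" for s b
    by (subst integral_measure_pmf[of UNIV]) auto
  then show ?thesis
    unfolding expected_potential_def history_law.simps
    by (subst expectation_bind_history[OF assms])
      (auto intro!: sum.cong simp: sum_distrib_right[symmetric] f)
qed

lemma abs_expected_potential_le:
  fixes u :: "'s::finite \<Rightarrow> real"
  assumes "wf_game G" and "f \<in> stationary1 G" and "\<sigma> \<in> history_dep2 G"
  shows "\<bar>expected_potential G u f \<sigma> t\<bar> \<le> (\<Sum>s\<in>UNIV. \<bar>u s\<bar>)"
proof -
  let ?M = "history_law G f \<sigma> t" and ?B = "\<Sum>s\<in>UNIV. \<bar>u s\<bar>"
  have "\<bar>expected_potential G u f \<sigma> t\<bar> \<le> (\<Sum>hs\<in>set_pmf ?M. \<bar>pmf ?M hs * (case hs of (h, s) \<Rightarrow> u s)\<bar>)"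
    unfolding expected_potential_def expectation_history[OF assms] by (rule sum_abs)
  also have "\<dots> \<le> (\<Sum>hs\<in>set_pmf ?M. pmf ?M hs * ?B)"
    by (intro sum_mono) (auto simp: abs_mult intro!: mult_left_mono member_le_sum)
  also have "\<dots> = ?B"
    using history_law_support(1)[OF assms, of t]
    by (simp add: sum_distrib_right[symmetric] sum_pmf_eq_1)
  finally show ?thesis .
qed

text \<open>
  Telescoping: the hypothesis bounds \<open>w\<close> by the expected stage cost plus the expected increment of
  \<open>u\<close> along the process, and the total increment stays bounded because there are finitely many states.
  The hypothesis averages over the choice of player 2, so that it covers both an inequality that holds
  for each action and one that holds only in the mean under a stationary strategy.
\<close>
lemma drift_lower_bound:
  fixes G :: "('s::finite, 'a, 'b) game"
  assumes "wf_game G" and "f \<in> stationary1 G" and "\<sigma> \<in> history_dep2 G"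
    and drift: "\<And>h s. set h \<subseteq> triples G \<Longrightarrow>
      w + u s \<le> (\<Sum>b\<in>act2 G s. pmf (\<sigma> h s) b *
        (mean_cost G c (\<lambda>s. pmf (f s)) s b + (\<Sum>s'\<in>UNIV. pmf (trans_prob G s b) s' * u s')))"
  shows "\<exists>B. \<forall>T>0. w - B / real T \<le> 1 / real T * (\<Sum>t<T. expected_stage_cost G c f \<sigma> t)"
proof -
  note strat = assms(1-3)
  let ?U = "expected_potential G u f \<sigma>"
  have step: "w + ?U t \<le> expected_stage_cost G c f \<sigma> t + ?U (Suc t)" for t
  proof -
    let ?M = "history_law G f \<sigma> t"
    have "(\<Sum>hs\<in>set_pmf ?M. pmf ?M hs) = 1"
      using history_law_support(1)[OF strat, of t] by (simp add: sum_pmf_eq_1)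
    then have "w + ?U t = (\<Sum>hs\<in>set_pmf ?M. pmf ?M hs * w) +
        (\<Sum>hs\<in>set_pmf ?M. pmf ?M hs * (case hs of (h, s) \<Rightarrow> u s))"
      unfolding expected_potential_def expectation_history[OF strat]
      by (simp add: sum_distrib_right[symmetric])
    also have "\<dots> = (\<Sum>(h, s)\<in>set_pmf ?M. pmf ?M (h, s) * (w + u s))"
      by (simp add: sum.distrib[symmetric] algebra_simps case_prod_unfold)
    also have "\<dots> \<le> (\<Sum>(h, s)\<in>set_pmf ?M. pmf ?M (h, s) * (\<Sum>b\<in>act2 G s. pmf (\<sigma> h s) b *
        (mean_cost G c (\<lambda>s. pmf (f s)) s b + (\<Sum>s'\<in>UNIV. pmf (trans_prob G s b) s' * u s'))))"
      using drift history_law_support(2)[OF strat] by (intro sum_mono) (auto intro!: mult_left_mono)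
    also have "\<dots> = expected_stage_cost G c f \<sigma> t + ?U (Suc t)"
      unfolding expected_stage_cost_history[OF strat] expected_potential_Suc[OF strat]
      by (simp add: sum.distrib case_prod_unfold distrib_left)
    finally show ?thesis .
  qed
  have telescope: "real T * w + ?U 0 \<le> (\<Sum>t<T. expected_stage_cost G c f \<sigma> t) + ?U T" for T
  proof (induction T)
    case (Suc T)
    then show ?case using step[of T] by (simp add: algebra_simps)
  qed simp
  \<comment> \<open>The two boundary terms are each bounded by the sum of the \<open>\<bar>u s\<bar>\<close>.\<close>
  define B where "B = 2 * (\<Sum>s\<in>UNIV. \<bar>u s\<bar>)"
  have "w - B / real T \<le> 1 / real T * (\<Sum>t<T. expected_stage_cost G c f \<sigma> t)" if "T > 0" for T
  proof -
    have "real T * w - B \<le> (\<Sum>t<T. expected_stage_cost G c f \<sigma> t)"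
      using telescope[of T] abs_expected_potential_le[OF strat, of u 0]
        abs_expected_potential_le[OF strat, of u T] by (simp add: B_def)
    from divide_right_mono[OF this, of "real T"] show ?thesis
      using that by (simp add: diff_divide_distrib)
  qed
  then show ?thesis by blast
qed

section \<open>Occupation measures and average costs\<close>

definition bilinear_cost ::
  "('s::finite, 'a, 'b) game \<Rightarrow> ('s \<Rightarrow> 'a \<Rightarrow> 'b \<Rightarrow> real) \<Rightarrow> ('s \<Rightarrow> 'a \<Rightarrow> real) \<Rightarrow> ('s \<Rightarrow> 'b \<Rightarrow> real) \<Rightarrow> real"
  where "bilinear_cost G c f x = (\<Sum>s\<in>UNIV. \<Sum>a\<in>act1 G s. \<Sum>b\<in>act2 G s. f s a * c s a b * x s b)"

lemma bilinear_cost_player1: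
  "bilinear_cost G c f x = (\<Sum>s\<in>UNIV. \<Sum>a\<in>act1 G s. (\<Sum>b\<in>act2 G s. c s a b * x s b) * f s a)"
  by (simp add: bilinear_cost_def sum_distrib_left sum_distrib_right mult_ac)

lemma sum_multipliers:
  fixes d :: "'k \<Rightarrow> 's::finite \<Rightarrow> 'i \<Rightarrow> real"
  shows "(\<Sum>s\<in>UNIV. \<Sum>i\<in>A s. (\<Sum>k\<in>K. \<delta> k * d k s i) * y s i) =
    (\<Sum>k\<in>K. \<delta> k * (\<Sum>s\<in>UNIV. \<Sum>i\<in>A s. d k s i * y s i))"
proof -
  have "(\<Sum>s\<in>UNIV. \<Sum>i\<in>A s. \<Sum>k\<in>K. \<delta> k * (d k s i * y s i)) =
      (\<Sum>s\<in>UNIV. \<Sum>k\<in>K. \<Sum>i\<in>A s. \<delta> k * (d k s i * y s i))"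
    by (intro sum.cong refl sum.swap)
  also have "\<dots> = (\<Sum>k\<in>K. \<Sum>s\<in>UNIV. \<Sum>i\<in>A s. \<delta> k * (d k s i * y s i))"
    by (rule sum.swap)
  finally show ?thesis
    by (simp only: sum_distrib_left sum_distrib_right mult.assoc)
qed

lemma bilinear_cost_player2:
  "bilinear_cost G c f x = (\<Sum>s\<in>UNIV. \<Sum>b\<in>act2 G s. mean_cost G c f s b * x s b)"
  unfolding bilinear_cost_def mean_cost_def sum_distrib_right
  by (intro sum.cong refl sum.swap)

definition occupation_measure :: "('s::finite, 'a, 'b) game \<Rightarrow> ('s \<Rightarrow> 'b \<Rightarrow> real) \<Rightarrow> bool" where
  "occupation_measure G x \<longleftrightarrow>
    (\<forall>s. \<forall>b\<in>act2 G s. x s b \<ge> 0) \<and> (\<Sum>s\<in>UNIV. \<Sum>b\<in>act2 G s. x s b) = 1 \<and>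
    (\<forall>s'. (\<Sum>s\<in>UNIV. \<Sum>b\<in>act2 G s.
      ((if s = s' then 1 else 0) - pmf (trans_prob G s b) s') * x s b) = 0)"

lemma balance_sum:
  fixes G :: "('s::finite, 'a, 'b) game"
  shows "(\<Sum>s\<in>UNIV. \<Sum>b\<in>act2 G s. ((if s = s' then 1 else 0) - pmf (trans_prob G s b) s') * x s b) =
    (\<Sum>b\<in>act2 G s'. x s' b) - (\<Sum>s\<in>UNIV. \<Sum>b\<in>act2 G s. pmf (trans_prob G s b) s' * x s b)"
proof -
  have "(\<Sum>b\<in>act2 G s. ((if s = s' then 1 else 0) - pmf (trans_prob G s b) s') * x s b) =
    (if s = s' then \<Sum>b\<in>act2 G s. x s b else 0) - (\<Sum>b\<in>act2 G s. pmf (trans_prob G s b) s' * x s b)" for s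
    by (simp add: left_diff_distrib sum_subtractf sum_negf)
  then show ?thesis by (simp add: sum_subtractf)
qed

lemma pmf_state_kernel:
  assumes "wf_game G" and "g \<in> stationary2 G"
  shows "pmf (state_kernel G g s) s' = (\<Sum>b\<in>act2 G s. pmf (g s) b * pmf (trans_prob G s b) s')"
  unfolding state_kernel_def pmf_bind
  using assms by (subst integral_measure_pmf[of "act2 G s"]) (auto simp: wf_game_def stationary2_def)

lemma sum_stationary2:
  assumes "wf_game G" and "g \<in> stationary2 G"
  shows "(\<Sum>b\<in>act2 G s. pmf (g s) b) = 1"
  using assms by (intro sum_pmf_eq_1) (auto simp: wf_game_def stationary2_def)

lemma sum_stationary1:
  assumes "wf_game G" and "f \<in> stationary1 G"
  shows "(\<Sum>a\<in>act1 G s. pmf (f s) a) = 1"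
  using assms by (intro sum_pmf_eq_1) (auto simp: wf_game_def stationary1_def)

text \<open>
  The measure \<open>m\<close> is the state marginal of \<open>x\<close>, and stationarity is the balance equation.  In a state
  without mass \<open>x\<close> vanishes, so the identity there holds with any choice of \<open>g\<close>.
\<close>
lemma occupation_measure_disintegration:
  assumes "wf_game G" and "g \<in> stationary2 G" and x: "occupation_measure G x" "normalises2 G g x"
  obtains m where "stationary_measure (state_kernel G g) m" and "(\<Sum>s\<in>UNIV. m s) = 1"
    and "\<And>s b. b \<in> act2 G s \<Longrightarrow> x s b = m s * pmf (g s) b"
proof -
  define m where "m = (\<lambda>s. \<Sum>b\<in>act2 G s. x s b)"
  have fin: "finite (act2 G s)" for s
    using assms(1) by (auto simp: wf_game_def)
  have x_nonneg: "x s b \<ge> 0" if "b \<in> act2 G s" for s b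
    using x(1) that by (auto simp: occupation_measure_def)
  have eq: "x s b = m s * pmf (g s) b" if "b \<in> act2 G s" for s b
  proof (cases "m s = 0")
    case True
    then have "x s b = 0"
      using that fin x_nonneg sum_nonneg_eq_0_iff[of "act2 G s" "x s"] by (auto simp: m_def)
    then show ?thesis using True by simp
  next
    case False
    then show ?thesis using x(2) that by (simp add: normalises2_def m_def)
  qed
  have "(\<Sum>s\<in>UNIV. m s * pmf (state_kernel G g s) s') = m s'" for s'
  proof -
    have "(\<Sum>s\<in>UNIV. m s * pmf (state_kernel G g s) s') =
        (\<Sum>s\<in>UNIV. \<Sum>b\<in>act2 G s. pmf (trans_prob G s b) s' * x s b)"
      unfolding pmf_state_kernel[OF assms(1,2)] sum_distrib_left
      by (intro sum.cong refl) (simp add: eq algebra_simps)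
    then show ?thesis
      using x(1) unfolding occupation_measure_def balance_sum by (simp add: m_def)
  qed
  moreover have "m s \<ge> 0" for s
    unfolding m_def using x_nonneg by (intro sum_nonneg) auto
  moreover have "(\<Sum>s\<in>UNIV. m s) = 1"
    using x(1) by (simp add: occupation_measure_def m_def)
  ultimately show ?thesis
    using eq by (intro that[of m]) (auto simp: stationary_measure_def)
qed

lemma occupation_measure_exists:
  assumes "wf_game G" and "g \<in> stationary2 G"
  obtains x where "occupation_measure G x" and "normalises2 G g x"
proof -
  obtain m where m: "stationary_measure (state_kernel G g) m" "(\<Sum>s\<in>UNIV. m s) = 1"
    using stationary_distribution_exists by blast
  define x where "x = (\<lambda>s b. m s * pmf (g s) b)"
  have total: "(\<Sum>b\<in>act2 G s. x s b) = m s" for s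
    using sum_stationary2[OF assms] by (simp add: x_def sum_distrib_left[symmetric])
  have "(\<Sum>s\<in>UNIV. \<Sum>b\<in>act2 G s. pmf (trans_prob G s b) s' * x s b) =
      (\<Sum>s\<in>UNIV. m s * pmf (state_kernel G g s) s')" for s'
    unfolding pmf_state_kernel[OF assms] sum_distrib_left
    by (intro sum.cong refl) (simp add: x_def algebra_simps)
  then have "occupation_measure G x"
    using m unfolding occupation_measure_def balance_sum total
    by (auto simp: stationary_measure_def x_def)
  moreover have "normalises2 G g x"
    unfolding normalises2_def total by (simp add: x_def)
  ultimately show ?thesis by (rule that)
qed

lemma bilinear_cost_disintegration:
  assumes "\<And>s b. b \<in> act2 G s \<Longrightarrow> x s b = m s * pmf (g s) b"
  shows "bilinear_cost G c f x = (\<Sum>s\<in>UNIV. (\<Sum>b\<in>act2 G s. pmf (g s) b * mean_cost G c f s b) * m s)"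
  unfolding bilinear_cost_player2 sum_distrib_right
  by (intro sum.cong refl) (simp add: assms algebra_simps)

lemma of_stationary_history_dep2: "g \<in> stationary2 G \<Longrightarrow> of_stationary g \<in> history_dep2 G"
  by (auto simp: of_stationary_def history_dep2_def stationary2_def)

lemma stationary_lower_bound:
  fixes G :: "('s::finite, 'a, 'b) game"
  assumes "wf_game G" and "unichain G" and "f \<in> stationary1 G" and "g \<in> stationary2 G"
    and "occupation_measure G x" and "normalises2 G g x"
  shows "\<exists>B. \<forall>T>0. bilinear_cost G c (\<lambda>s. pmf (f s)) x - B / real T
    \<le> 1 / real T * (\<Sum>t<T. expected_stage_cost G c f (of_stationary g) t)"
proof -
  obtain m where m: "stationary_measure (state_kernel G g) m" "(\<Sum>s\<in>UNIV. m s) = 1"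
    "\<And>s b. b \<in> act2 G s \<Longrightarrow> x s b = m s * pmf (g s) b"
    using occupation_measure_disintegration assms by blast
  let ?c = "\<lambda>s. \<Sum>b\<in>act2 G s. pmf (g s) b * mean_cost G c (\<lambda>s. pmf (f s)) s b"
  let ?w = "bilinear_cost G c (\<lambda>s. pmf (f s)) x"
  have "\<exists>!C. C \<in> recurrent_classes (state_kernel G g)"
    using assms by (auto simp: unichain_def)
  from potential_exists[OF this m(1,2), of ?c] obtain u where
    u: "\<And>s. ?w + u s \<le> ?c s + (\<Sum>s'\<in>UNIV. pmf (state_kernel G g s) s' * u s')"
    using bilinear_cost_disintegration[where x = x and m = m and g = g and G = G, OF m(3)] by auto
  have kernel: "(\<Sum>s'\<in>UNIV. pmf (state_kernel G g s) s' * u s') =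
      (\<Sum>b\<in>act2 G s. pmf (g s) b * (\<Sum>s'\<in>UNIV. pmf (trans_prob G s b) s' * u s'))" for s
    unfolding pmf_state_kernel[OF assms(1,4)] sum_distrib_left sum_distrib_right
    by (subst sum.swap) (simp add: mult.assoc)
  show ?thesis
  proof (rule drift_lower_bound)
    fix h s
    show "?w + u s \<le> (\<Sum>b\<in>act2 G s. pmf (of_stationary g h s) b *
        (mean_cost G c (\<lambda>s. pmf (f s)) s b + (\<Sum>s'\<in>UNIV. pmf (trans_prob G s b) s' * u s')))"
      using u[of s] unfolding kernel by (simp add: of_stationary_def distrib_left sum.distrib)
  qed (use assms of_stationary_history_dep2 in auto)
qed

text \<open>
  The link between the game and the program.  The lower bound by potentials applies to \<open>c\<close> and to \<open>-c\<close>, so the averages converge and the limit superior is a limit.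
\<close>
lemma average_cost_of_stationary:
  fixes G :: "('s::finite, 'a, 'b) game"
  assumes "wf_game G" and "unichain G" and "f \<in> stationary1 G" and "g \<in> stationary2 G"
    and "occupation_measure G x" and "normalises2 G g x"
  shows "average_cost G c f (of_stationary g) = ereal (bilinear_cost G c (\<lambda>s. pmf (f s)) x)"
proof -
  let ?w = "bilinear_cost G c (\<lambda>s. pmf (f s)) x"
  let ?A = "\<lambda>T. 1 / real T * (\<Sum>t<T. expected_stage_cost G c f (of_stationary g) t)"
  have neg: "bilinear_cost G (\<lambda>s a b. - c s a b) (\<lambda>s. pmf (f s)) x = - ?w"
    by (simp add: bilinear_cost_def sum_negf)
  have neg_stage: "expected_stage_cost G (\<lambda>s a b. - c s a b) f \<sigma> t = - expected_stage_cost G c f \<sigma> t" for \<sigma> t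
    unfolding expected_stage_cost_def
    by (simp add: case_prod_unfold)
  obtain B1 where B1: "\<forall>T>0. ?w - B1 / real T \<le> ?A T"
    using stationary_lower_bound[OF assms] by blast
  obtain B2 where B2: "\<forall>T>0. - ?w - B2 / real T \<le> - ?A T"
    using stationary_lower_bound[OF assms, of "\<lambda>s a b. - c s a b"]
    unfolding neg neg_stage sum_negf by auto
  have upper: "?A T \<le> ?w + B2 / real T" if "T > 0" for T
    using B2[rule_format, OF that] by linarith
  have "?A \<longlonglongrightarrow> ?w"
  proof (rule tendsto_sandwich)
    show "\<forall>\<^sub>F T in sequentially. ?w - B1 / real T \<le> ?A T"
      using B1 by (intro eventually_sequentiallyI[of 1]) auto
    show "\<forall>\<^sub>F T in sequentially. ?A T \<le> ?w + B2 / real T"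
      using upper by (intro eventually_sequentiallyI[of 1]) auto
    show "(\<lambda>T. ?w - B1 / real T) \<longlonglongrightarrow> ?w"
      using tendsto_diff[OF tendsto_const[of ?w] lim_const_over_n[of B1]] by simp
    show "(\<lambda>T. ?w + B2 / real T) \<longlonglongrightarrow> ?w"
      using tendsto_add[OF tendsto_const[of ?w] lim_const_over_n[of B2]] by simp
  qed
  then have "limsup (\<lambda>T. ereal (?A T)) = ereal ?w"
    by (intro lim_imp_Limsup) auto
  then show ?thesis
    by (simp add: average_cost_def expected_stage_cost_def)
qed

section \<open>The two linear programs behind the mathematical program\<close>

definition dual_certificate2 ::
  "('s::finite, 'a, 'b) game \<Rightarrow> ('s \<Rightarrow> 'a \<Rightarrow> real) \<Rightarrow> real \<Rightarrow> ('s \<Rightarrow> real) \<Rightarrow> (nat \<Rightarrow> real) \<Rightarrow> bool" where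
  "dual_certificate2 G f v u \<delta> \<longleftrightarrow>
    (\<forall>l\<in>{1..num_con G}. \<delta> l \<ge> 0) \<and>
    (\<forall>s. \<forall>b\<in>act2 G s. v + u s \<le> mean_cost G (cost2 G) f s b
      + (\<Sum>l = 1..num_con G. \<delta> l * mean_cost G (con_cost G l) f s b)
      + (\<Sum>s'\<in>UNIV. pmf (trans_prob G s b) s' * u s'))"

definition dual_value2 :: "('s, 'a, 'b) game \<Rightarrow> real \<Rightarrow> (nat \<Rightarrow> real) \<Rightarrow> real" where
  "dual_value2 G v \<delta> = v - (\<Sum>l = 1..num_con G. \<delta> l * con_bound G l)"

definition dual_certificate1 ::
  "('s::finite, 'a, 'b) game \<Rightarrow> ('s \<Rightarrow> 'b \<Rightarrow> real) \<Rightarrow> ('s \<Rightarrow> real) \<Rightarrow> (nat \<Rightarrow> real) \<Rightarrow> bool" where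
  "dual_certificate1 G x z \<delta> \<longleftrightarrow>
    (\<forall>k\<in>{1..num_sub G}. \<delta> k \<ge> 0) \<and>
    (\<forall>s. \<forall>a\<in>act1 G s. z s \<le> (\<Sum>b\<in>act2 G s. cost1 G s a b * x s b)
      + (\<Sum>k = 1..num_sub G. \<delta> k * sub_cost G k s a))"

definition dual_value1 :: "('s::finite, 'a, 'b) game \<Rightarrow> ('s \<Rightarrow> real) \<Rightarrow> (nat \<Rightarrow> real) \<Rightarrow> real" where
  "dual_value1 G z \<delta> = (\<Sum>s\<in>UNIV. z s) - (\<Sum>k = 1..num_sub G. \<delta> k * sub_bound G k)"

definition strategy_weights1 :: "('s, 'a, 'b) game \<Rightarrow> ('s \<Rightarrow> 'a \<Rightarrow> real) \<Rightarrow> bool" where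
  "strategy_weights1 G f \<longleftrightarrow>
    (\<forall>s. (\<Sum>a\<in>act1 G s. f s a) = 1) \<and> (\<forall>s. \<forall>a\<in>act1 G s. f s a \<ge> 0)"

definition sub_feasible :: "('s::finite, 'a, 'b) game \<Rightarrow> ('s \<Rightarrow> 'a \<Rightarrow> real) \<Rightarrow> bool" where
  "sub_feasible G f \<longleftrightarrow>
    (\<forall>k\<in>{1..num_sub G}. (\<Sum>s\<in>UNIV. \<Sum>a\<in>act1 G s. sub_cost G k s a * f s a) \<le> sub_bound G k)"

definition con_feasible :: "('s::finite, 'a, 'b) game \<Rightarrow> ('s \<Rightarrow> 'a \<Rightarrow> real) \<Rightarrow> ('s \<Rightarrow> 'b \<Rightarrow> real) \<Rightarrow> bool" where
  "con_feasible G f x \<longleftrightarrow> (\<forall>l\<in>{1..num_con G}. bilinear_cost G (con_cost G l) f x \<le> con_bound G l)"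

text \<open>
  For fixed \<open>x\<close>, player 1 minimises a linear function of \<open>f\<close>; for fixed \<open>f\<close>, player 2 minimises a
  linear function of \<open>x\<close>.  The program consists of the primal and dual constraints of both problems.
  Its objective is the sum of the two duality gaps.
\<close>
lemma mp_feasible_iff:
  "mp_feasible G \<eta> \<longleftrightarrow>
    strategy_weights1 G (mp_f \<eta>) \<and> occupation_measure G (mp_x \<eta>) \<and>
    sub_feasible G (mp_f \<eta>) \<and> con_feasible G (mp_f \<eta>) (mp_x \<eta>) \<and>
    dual_certificate1 G (mp_x \<eta>) (mp_z \<eta>) (mp_d1 \<eta>) \<and>
    dual_certificate2 G (mp_f \<eta>) (mp_v \<eta>) (mp_u \<eta>) (mp_d2 \<eta>)"
  unfolding mp_feasible_def strategy_weights1_def occupation_measure_def sub_feasible_def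
    con_feasible_def dual_certificate1_def dual_certificate2_def mean_cost_def bilinear_cost_def
  by (rule iffI; elim conjE; intro conjI; assumption)

lemma mp_objective_eq:
  "mp_objective G \<eta> =
    (bilinear_cost G (cost1 G) (mp_f \<eta>) (mp_x \<eta>) - dual_value1 G (mp_z \<eta>) (mp_d1 \<eta>)) +
    (bilinear_cost G (cost2 G) (mp_f \<eta>) (mp_x \<eta>) - dual_value2 G (mp_v \<eta>) (mp_d2 \<eta>))"
  by (simp add: mp_objective_def bilinear_cost_def dual_value1_def dual_value2_def)

lemma weak_duality1:
  assumes f: "strategy_weights1 G f" "sub_feasible G f" and cert: "dual_certificate1 G x z \<delta>"
  shows "dual_value1 G z \<delta> \<le> bilinear_cost G (cost1 G) f x"
proof -
  let ?d = "\<lambda>s a. \<Sum>k = 1..num_sub G. \<delta> k * sub_cost G k s a"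
  have "(\<Sum>s\<in>UNIV. z s) = (\<Sum>s\<in>UNIV. \<Sum>a\<in>act1 G s. z s * f s a)"
    using f(1) by (simp add: strategy_weights1_def sum_distrib_left[symmetric])
  also have "\<dots> \<le> (\<Sum>s\<in>UNIV. \<Sum>a\<in>act1 G s. ((\<Sum>b\<in>act2 G s. cost1 G s a b * x s b) + ?d s a) * f s a)"
    using f(1) cert
    by (intro sum_mono mult_right_mono) (auto simp: strategy_weights1_def dual_certificate1_def)
  also have "\<dots> = bilinear_cost G (cost1 G) f x + (\<Sum>s\<in>UNIV. \<Sum>a\<in>act1 G s. ?d s a * f s a)"
    unfolding bilinear_cost_player1 by (simp add: distrib_right sum.distrib)
  also have "(\<Sum>s\<in>UNIV. \<Sum>a\<in>act1 G s. ?d s a * f s a) =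
      (\<Sum>k = 1..num_sub G. \<delta> k * (\<Sum>s\<in>UNIV. \<Sum>a\<in>act1 G s. sub_cost G k s a * f s a))"
    by (rule sum_multipliers)
  also have "\<dots> \<le> (\<Sum>k = 1..num_sub G. \<delta> k * sub_bound G k)"
    using f(2) cert
    by (intro sum_mono mult_left_mono) (auto simp: sub_feasible_def dual_certificate1_def)
  finally show ?thesis by (simp add: dual_value1_def)
qed

text \<open>
  Summing the dual inequalities with weights \<open>x\<close> cancels \<open>u\<close>, because \<open>x\<close> satisfies the balance
  equations.
\<close>
lemma weak_duality2:
  assumes x: "occupation_measure G x" "con_feasible G f x" and cert: "dual_certificate2 G f v u \<delta>"
  shows "dual_value2 G v \<delta> \<le> bilinear_cost G (cost2 G) f x"
proof -
  let ?d = "\<lambda>s b. \<Sum>l = 1..num_con G. \<delta> l * mean_cost G (con_cost G l) f s b"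
  let ?P = "\<lambda>s b. \<Sum>s'\<in>UNIV. pmf (trans_prob G s b) s' * u s'"
  have "(\<Sum>s\<in>UNIV. \<Sum>b\<in>act2 G s. ?P s b * x s b) =
      (\<Sum>s'\<in>UNIV. u s' * (\<Sum>s\<in>UNIV. \<Sum>b\<in>act2 G s. pmf (trans_prob G s b) s' * x s b))"
    unfolding sum_distrib_left sum_distrib_right
    by (subst sum.swap[of _ UNIV UNIV])
      (intro sum.cong refl, subst sum.swap, simp add: algebra_simps)
  also have "\<dots> = (\<Sum>s\<in>UNIV. \<Sum>b\<in>act2 G s. u s * x s b)"
    using x(1) unfolding occupation_measure_def balance_sum by (simp add: sum_distrib_left[symmetric])
  finally have P: "(\<Sum>s\<in>UNIV. \<Sum>b\<in>act2 G s. ?P s b * x s b) = (\<Sum>s\<in>UNIV. \<Sum>b\<in>act2 G s. u s * x s b)" .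
  have d: "(\<Sum>s\<in>UNIV. \<Sum>b\<in>act2 G s. ?d s b * x s b) =
      (\<Sum>l = 1..num_con G. \<delta> l * bilinear_cost G (con_cost G l) f x)"
    unfolding bilinear_cost_player2 by (rule sum_multipliers)
  have "v + (\<Sum>s\<in>UNIV. \<Sum>b\<in>act2 G s. u s * x s b) = (\<Sum>s\<in>UNIV. \<Sum>b\<in>act2 G s. (v + u s) * x s b)"
    using x(1) by (simp add: occupation_measure_def distrib_right sum.distrib sum_distrib_left[symmetric])
  also have "\<dots> \<le> (\<Sum>s\<in>UNIV. \<Sum>b\<in>act2 G s. (mean_cost G (cost2 G) f s b + ?d s b + ?P s b) * x s b)"
    using x(1) cert
    by (intro sum_mono mult_right_mono) (auto simp: occupation_measure_def dual_certificate2_def)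
  also have "\<dots> = bilinear_cost G (cost2 G) f x +
      (\<Sum>l = 1..num_con G. \<delta> l * bilinear_cost G (con_cost G l) f x) +
      (\<Sum>s\<in>UNIV. \<Sum>b\<in>act2 G s. u s * x s b)"
    unfolding bilinear_cost_player2[of G "cost2 G"] d[symmetric] P[symmetric]
    by (simp add: distrib_right sum.distrib)
  also have "(\<Sum>l = 1..num_con G. \<delta> l * bilinear_cost G (con_cost G l) f x) \<le>
      (\<Sum>l = 1..num_con G. \<delta> l * con_bound G l)"
    using x(2) cert
    by (intro sum_mono mult_left_mono) (auto simp: con_feasible_def dual_certificate2_def)
  finally show ?thesis by (simp add: dual_value2_def)
qed

text \<open>
  A dual certificate also controls feasible strategies that depend on the history:
  it is a drift inequality for the cost \<open>cost2 + (\<Sum>l. \<delta> l * con_cost l)\<close>.  The limits superior of the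
  constraint averages are at most their bounds, so in the long run these averages exceed the bounds by
  at most \<open>e\<close>, and what remains of the drift inequality bounds the averages of \<open>cost2\<close>.
\<close>
lemma lagrangian_lower_bound:
  fixes G :: "('s::finite, 'a, 'b) game"
  assumes "wf_game G" and "f \<in> stationary1 G" and "\<sigma> \<in> history_dep2 G"
    and feas: "feasible2 G f \<sigma>"
    and cert: "dual_certificate2 G (\<lambda>s. pmf (f s)) v u \<delta>"
  shows "ereal (dual_value2 G v \<delta>) \<le> average_cost G (cost2 G) f \<sigma>"
proof -
  note strat = assms(1-3)
  let ?\<phi> = "\<lambda>s. pmf (f s)"
  let ?L = "{1..num_con G}"
  let ?A = "\<lambda>c T. 1 / real T * (\<Sum>t<T. expected_stage_cost G c f \<sigma> t)"
  define c where "c = (\<lambda>s a b. cost2 G s a b + (\<Sum>l\<in>?L. \<delta> l * con_cost G l s a b))"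
  have mean: "mean_cost G c ?\<phi> s b =
      mean_cost G (cost2 G) ?\<phi> s b + (\<Sum>l\<in>?L. \<delta> l * mean_cost G (con_cost G l) ?\<phi> s b)" for s b
    unfolding mean_cost_def c_def
    by (simp add: distrib_left sum.distrib sum_distrib_left mult.left_commute) (rule sum.swap)
  have stage: "expected_stage_cost G c f \<sigma> t =
      expected_stage_cost G (cost2 G) f \<sigma> t + (\<Sum>l\<in>?L. \<delta> l * expected_stage_cost G (con_cost G l) f \<sigma> t)" for t
  proof -
    let ?M = "history_law G f \<sigma> t"
    have lin: "expected_stage_cost G d f \<sigma> t = (\<Sum>hs\<in>set_pmf ?M. \<Sum>b\<in>act2 G (snd hs).
        pmf ?M hs * pmf (\<sigma> (fst hs) (snd hs)) b * mean_cost G d ?\<phi> (snd hs) b)" for d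
      unfolding expected_stage_cost_history[OF strat]
      by (simp add: case_prod_unfold sum_distrib_left mult.assoc)
    let ?p = "\<lambda>hs b. pmf ?M hs * pmf (\<sigma> (fst hs) (snd hs)) b"
    have "(\<Sum>l\<in>?L. \<delta> l * expected_stage_cost G (con_cost G l) f \<sigma> t) =
        (\<Sum>hs\<in>set_pmf ?M. \<Sum>l\<in>?L. \<Sum>b\<in>act2 G (snd hs).
          \<delta> l * (?p hs b * mean_cost G (con_cost G l) ?\<phi> (snd hs) b))"
      unfolding lin sum_distrib_left by (rule sum.swap)
    also have "\<dots> = (\<Sum>hs\<in>set_pmf ?M. \<Sum>b\<in>act2 G (snd hs). \<Sum>l\<in>?L.
          \<delta> l * (?p hs b * mean_cost G (con_cost G l) ?\<phi> (snd hs) b))"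
      by (intro sum.cong refl sum.swap)
    finally show ?thesis
      unfolding lin mean by (simp add: distrib_left sum.distrib sum_distrib_left mult.left_commute)
  qed
  have avg: "?A c T = ?A (cost2 G) T + (\<Sum>l\<in>?L. \<delta> l * ?A (con_cost G l) T)" for T
  proof -
    have "(\<Sum>t<T. expected_stage_cost G c f \<sigma> t) = (\<Sum>t<T. expected_stage_cost G (cost2 G) f \<sigma> t) +
        (\<Sum>l\<in>?L. \<delta> l * (\<Sum>t<T. expected_stage_cost G (con_cost G l) f \<sigma> t))"
      unfolding stage sum.distrib sum_distrib_left
      by (intro arg_cong2[where f = plus] refl sum.swap)
    then show ?thesis
      by (simp add: distrib_left sum_distrib_left mult.left_commute add_divide_distrib sum_divide_distrib)
  qed
  have "\<exists>B. \<forall>T>0. v - B / real T \<le> ?A c T"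
  proof (rule drift_lower_bound[OF strat])
    fix h s assume h: "set h \<subseteq> triples G"
    let ?r = "\<lambda>b. mean_cost G c ?\<phi> s b + (\<Sum>s'\<in>UNIV. pmf (trans_prob G s b) s' * u s')"
    have "(\<Sum>b\<in>act2 G s. pmf (\<sigma> h s) b) = 1"
      using strat(1,3) h by (intro sum_pmf_eq_1) (auto simp: wf_game_def history_dep2_def)
    then have "v + u s = (\<Sum>b\<in>act2 G s. pmf (\<sigma> h s) b * (v + u s))"
      by (simp add: sum_distrib_right[symmetric])
    also have "\<dots> \<le> (\<Sum>b\<in>act2 G s. pmf (\<sigma> h s) b * ?r b)"
      using cert unfolding mean
      by (intro sum_mono mult_left_mono) (auto simp: dual_certificate2_def)
    finally show "v + u s \<le> (\<Sum>b\<in>act2 G s. pmf (\<sigma> h s) b * ?r b)" .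
  qed
  then obtain B where B: "\<And>T. T > 0 \<Longrightarrow> v - B / real T \<le> ?A c T" by blast
  have \<delta>: "\<And>l. l \<in> ?L \<Longrightarrow> \<delta> l \<ge> 0" using cert by (simp add: dual_certificate2_def)
  show ?thesis
  proof (rule ereal_le_epsilon2)
    fix \<epsilon> :: real assume "\<epsilon> > 0"
    \<comment> \<open>An error of \<open>e\<close> in the \<open>cost2\<close> average and in each constraint average adds up to \<open>\<epsilon>\<close>.\<close>
    define e where "e = \<epsilon> / (1 + (\<Sum>l\<in>?L. \<delta> l))"
    have pos: "1 + (\<Sum>l\<in>?L. \<delta> l) > 0" using \<delta> sum_nonneg[of ?L \<delta>] by force
    have "e > 0" using pos \<open>\<epsilon> > 0\<close> by (simp add: e_def)
    have "e + (\<Sum>l\<in>?L. \<delta> l * e) = (1 + (\<Sum>l\<in>?L. \<delta> l)) * e"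
      by (simp only: distrib_right sum_distrib_right mult_1)
    then have e: "e + (\<Sum>l\<in>?L. \<delta> l * e) = \<epsilon>"
      using pos by (simp add: e_def)
    have "\<forall>\<^sub>F T in sequentially. ?A (con_cost G l) T \<le> con_bound G l + e" if "l \<in> ?L" for l
    proof -
      have "limsup (\<lambda>T. ereal (?A (con_cost G l) T)) \<le> ereal (con_bound G l)"
        using feas that by (simp add: feasible2_def average_cost_def expected_stage_cost_def)
      also have "\<dots> < ereal (con_bound G l + e)" using \<open>e > 0\<close> by simp
      finally have "\<forall>\<^sub>F T in sequentially. ereal (?A (con_cost G l) T) < ereal (con_bound G l + e)"
        by (rule Limsup_lessD)
      then show ?thesis by (rule eventually_mono) simp
    qed
    then have "\<forall>\<^sub>F T in sequentially. \<forall>l\<in>?L. ?A (con_cost G l) T \<le> con_bound G l + e"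
      by (simp add: eventually_ball_finite)
    moreover have "\<forall>\<^sub>F T in sequentially. B / real T < e"
      using lim_const_over_n[of B] \<open>e > 0\<close> by (rule order_tendstoD(2))
    moreover have "\<forall>\<^sub>F T in sequentially. T > 0" by (rule eventually_gt_at_top)
    ultimately have "\<forall>\<^sub>F T in sequentially. ereal (dual_value2 G v \<delta> - \<epsilon>) \<le> ereal (?A (cost2 G) T)"
    proof eventually_elim
      case (elim T)
      have "(\<Sum>l\<in>?L. \<delta> l * ?A (con_cost G l) T) \<le> (\<Sum>l\<in>?L. \<delta> l * (con_bound G l + e))"
        using elim \<delta> by (intro sum_mono mult_left_mono) auto
      also have "\<dots> = (\<Sum>l\<in>?L. \<delta> l * con_bound G l) + (\<Sum>l\<in>?L. \<delta> l * e)"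
        by (simp add: distrib_left sum.distrib)
      finally have "dual_value2 G v \<delta> - \<epsilon> \<le> ?A (cost2 G) T"
        using B[of T] elim e unfolding avg dual_value2_def by linarith
      then show ?case by simp
    qed
    then have "ereal (dual_value2 G v \<delta> - \<epsilon>) \<le> average_cost G (cost2 G) f \<sigma>"
      unfolding average_cost_def expected_stage_cost_def by (intro le_Limsup) simp_all
    from add_right_mono[OF this, of "ereal \<epsilon>"]
    show "ereal (dual_value2 G v \<delta>) \<le> average_cost G (cost2 G) f \<sigma> + ereal \<epsilon>"
      by simp
  qed
qed

section \<open>From vectors to strategies\<close>

lemma pmf_of_weights:
  assumes "finite A" and "\<And>a. a \<in> A \<Longrightarrow> w a \<ge> (0::real)" and "(\<Sum>a\<in>A. w a) = 1"
  shows "\<exists>p. set_pmf p \<subseteq> A \<and> (\<forall>a\<in>A. pmf p a = w a)"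
proof -
  define w' where "w' = (\<lambda>a. if a \<in> A then w a else 0)"
  have nonneg: "w' a \<ge> 0" for a using assms(2) by (simp add: w'_def)
  have "(\<integral>\<^sup>+a. ennreal (w' a) \<partial>count_space UNIV) = (\<Sum>a\<in>A. ennreal (w' a))"
    using assms(1) by (intro nn_integral_count_space'[of A]) (auto simp: w'_def)
  also have "\<dots> = 1"
    using assms(2,3) by (subst sum_ennreal) (auto simp: w'_def)
  finally have "pmf (embed_pmf w') a = w' a" for a
    using nonneg by (intro pmf_embed_pmf) auto
  then show ?thesis
    by (intro exI[of _ "embed_pmf w'"]) (auto simp: w'_def set_pmf_eq split: if_splits)
qed

lemma stationary1_of_weights:
  assumes "wf_game G" and "strategy_weights1 G w"
  obtains f where "f \<in> stationary1 G" and "has_weights1 G f w"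
proof -
  have "\<forall>s. \<exists>p. set_pmf p \<subseteq> act1 G s \<and> (\<forall>a\<in>act1 G s. pmf p a = w s a)"
    using assms by (intro allI pmf_of_weights) (auto simp: wf_game_def strategy_weights1_def)
  then obtain f where "\<forall>s. set_pmf (f s) \<subseteq> act1 G s \<and> (\<forall>a\<in>act1 G s. pmf (f s) a = w s a)"
    by metis
  then show ?thesis by (intro that[of f]) (auto simp: stationary1_def has_weights1_def)
qed

lemma normalisation_exists:
  assumes "wf_game G" and x: "\<And>s b. b \<in> act2 G s \<Longrightarrow> x s b \<ge> 0"
  obtains g where "g \<in> stationary2 G" and "normalises2 G g x"
proof -
  have "\<exists>p. set_pmf p \<subseteq> act2 G s \<and> ((\<Sum>b\<in>act2 G s. x s b) \<noteq> 0 \<longrightarrow>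
      (\<forall>b\<in>act2 G s. pmf p b = x s b / (\<Sum>b'\<in>act2 G s. x s b')))" for s
  proof (cases "(\<Sum>b\<in>act2 G s. x s b) = 0")
    case True
    \<comment> \<open>Any distribution on the admissible actions will do here.\<close>
    obtain b where "b \<in> act2 G s" using assms(1) by (auto simp: wf_game_def)
    then show ?thesis using True by (intro exI[of _ "return_pmf b"]) auto
  next
    case False
    have "(\<Sum>b\<in>act2 G s. x s b / (\<Sum>b'\<in>act2 G s. x s b')) = 1"
      using False by (simp add: sum_divide_distrib[symmetric])
    moreover have "x s b / (\<Sum>b'\<in>act2 G s. x s b') \<ge> 0" if "b \<in> act2 G s" for b
      using x that by (intro divide_nonneg_nonneg sum_nonneg) auto
    ultimately show ?thesis
      using pmf_of_weights[of "act2 G s" "\<lambda>b. x s b / (\<Sum>b'\<in>act2 G s. x s b')"] assms(1)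
      by (auto simp: wf_game_def)
  qed
  then obtain g where "\<forall>s. set_pmf (g s) \<subseteq> act2 G s \<and> ((\<Sum>b\<in>act2 G s. x s b) \<noteq> 0 \<longrightarrow>
      (\<forall>b\<in>act2 G s. pmf (g s) b = x s b / (\<Sum>b'\<in>act2 G s. x s b')))"
    by metis
  then show ?thesis by (intro that[of g]) (auto simp: stationary2_def normalises2_def)
qed

lemma bilinear_cost_cong:
  assumes "has_weights1 G f w"
  shows "bilinear_cost G c (\<lambda>s. pmf (f s)) x = bilinear_cost G c w x"
  using assms by (auto simp: bilinear_cost_def has_weights1_def intro!: sum.cong)

lemma mean_cost_cong:
  assumes "has_weights1 G f w"
  shows "mean_cost G c (\<lambda>s. pmf (f s)) = mean_cost G c w"
  using assms by (auto simp: mean_cost_def has_weights1_def fun_eq_iff intro!: sum.cong)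

lemma feasible1_iff:
  assumes "has_weights1 G f w"
  shows "feasible1 G f \<longleftrightarrow> sub_feasible G w"
  using assms by (simp add: feasible1_def sub_feasible_def has_weights1_def)

lemma strategy_weights1_stationary1:
  assumes "wf_game G" and "f \<in> stationary1 G"
  shows "strategy_weights1 G (\<lambda>s. pmf (f s))"
  using sum_stationary1[OF assms] by (simp add: strategy_weights1_def)

section \<open>Equilibria and zeros of the objective\<close>

lemma sum_Sigma_UNIV:
  fixes A :: "'s::finite \<Rightarrow> 'i set"
  assumes "\<And>s. finite (A s)"
  shows "(\<Sum>i\<in>Sigma UNIV A. h i) = (\<Sum>s\<in>UNIV. \<Sum>a\<in>A s. h (s, a))"
  using assms by (subst sum.Sigma) auto

text \<open>
  Linear programming duality for the best reply of player 1; \<open>z\<close> are the multipliers of the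
  normalisation of \<open>f\<close> in each state.
\<close>
lemma player1_certificate:
  fixes G :: "('s::finite, 'a, 'b) game"
  assumes wf: "wf_game G" and f: "strategy_weights1 G f" "sub_feasible G f"
    and opt: "\<And>f'. \<lbrakk>strategy_weights1 G f'; sub_feasible G f'\<rbrakk>
      \<Longrightarrow> bilinear_cost G (cost1 G) f x \<le> bilinear_cost G (cost1 G) f' x"
  obtains z \<delta> where "dual_certificate1 G x z \<delta>"
    and "bilinear_cost G (cost1 G) f x \<le> dual_value1 G z \<delta>"
proof -
  let ?I = "Sigma UNIV (act1 G)"
  have fin: "finite (act1 G s)" for s using wf by (auto simp: wf_game_def)
  define c where "c = (\<lambda>(s, a). \<Sum>b\<in>act2 G s. cost1 G s a b * x s b)"
  define E :: "'s \<Rightarrow> 's \<times> 'a \<Rightarrow> real" where "E = (\<lambda>s' (s, a). if s = s' then 1 else 0)"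
  define D where "D = (\<lambda>k (s, a). sub_cost G k s a)"
  have c: "(\<Sum>i\<in>?I. c i * y i) = bilinear_cost G (cost1 G) (curry y) x" for y
    by (simp add: sum_Sigma_UNIV fin c_def bilinear_cost_player1)
  have E: "(\<Sum>i\<in>?I. E s i * y i) = (\<Sum>a\<in>act1 G s. curry y s a)" for s y
  proof -
    have "(\<Sum>a\<in>act1 G s'. E s (s', a) * y (s', a)) =
        (if s' = s then \<Sum>a\<in>act1 G s'. y (s', a) else 0)" for s'
      by (simp add: E_def)
    then show ?thesis by (simp add: sum_Sigma_UNIV fin)
  qed
  have D: "(\<Sum>i\<in>?I. D k i * y i) = (\<Sum>s\<in>UNIV. \<Sum>a\<in>act1 G s. sub_cost G k s a * curry y s a)" for k y
    by (simp add: sum_Sigma_UNIV fin D_def)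
  have "\<exists>w \<delta>. (\<forall>k\<in>{1..num_sub G}. \<delta> k \<ge> 0) \<and>
    (\<forall>i\<in>?I. (\<Sum>s\<in>UNIV. w s * E s i) \<le> c i + (\<Sum>k\<in>{1..num_sub G}. \<delta> k * D k i)) \<and>
    (\<Sum>i\<in>?I. c i * case_prod f i) \<le> (\<Sum>s\<in>UNIV. w s * 1) - (\<Sum>k\<in>{1..num_sub G}. \<delta> k * sub_bound G k)"
  proof (rule lp_strong_duality)
    fix y :: "'s \<times> 'a \<Rightarrow> real"
    assume y: "\<And>i. i \<in> ?I \<Longrightarrow> y i \<ge> 0" "\<And>s. s \<in> UNIV \<Longrightarrow> (\<Sum>i\<in>?I. E s i * y i) = 1"
      "\<And>k. k \<in> {1..num_sub G} \<Longrightarrow> (\<Sum>i\<in>?I. D k i * y i) \<le> sub_bound G k"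
    have "strategy_weights1 G (curry y)"
      using y(1,2) by (simp add: E strategy_weights1_def)
    moreover have "sub_feasible G (curry y)"
      using y(3) unfolding D by (simp add: sub_feasible_def)
    ultimately show "(\<Sum>i\<in>?I. c i * case_prod f i) \<le> (\<Sum>i\<in>?I. c i * y i)"
      using opt unfolding c by simp
  qed (use f fin in \<open>auto simp: E D strategy_weights1_def sub_feasible_def\<close>)
  then obtain w \<delta> where w: "\<forall>k\<in>{1..num_sub G}. \<delta> k \<ge> 0"
    "\<forall>i\<in>?I. (\<Sum>s\<in>UNIV. w s * E s i) \<le> c i + (\<Sum>k = 1..num_sub G. \<delta> k * D k i)"
    "(\<Sum>i\<in>?I. c i * case_prod f i) \<le> (\<Sum>s\<in>UNIV. w s * 1) - (\<Sum>k = 1..num_sub G. \<delta> k * sub_bound G k)"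
    by blast
  have "(\<Sum>s'\<in>UNIV. w s' * E s' (s, a)) = w s" for s a
    by (simp add: E_def if_distrib cong: if_cong)
  then have "dual_certificate1 G x w \<delta>"
    using w(1) w(2)[rule_format, of "(_, _)"] by (simp add: dual_certificate1_def c_def D_def)
  moreover have "bilinear_cost G (cost1 G) f x \<le> dual_value1 G w \<delta>"
    using w(3) unfolding c by (simp add: dual_value1_def)
  ultimately show ?thesis by (rule that)
qed

text \<open>
  Linear programming duality for the best reply of player 2; \<open>v\<close> is the multiplier of the total mass
  of \<open>x\<close>, indexed by \<open>None\<close>, and \<open>u s\<close> that of the balance equation at \<open>s\<close>, indexed by \<open>Some s\<close>.
\<close>
lemma player2_certificate:
  fixes G :: "('s::finite, 'a, 'b) game"
  assumes wf: "wf_game G" and x: "occupation_measure G x" "con_feasible G f x"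
    and opt: "\<And>x'. \<lbrakk>occupation_measure G x'; con_feasible G f x'\<rbrakk>
      \<Longrightarrow> bilinear_cost G (cost2 G) f x \<le> bilinear_cost G (cost2 G) f x'"
  obtains v u \<delta> where "dual_certificate2 G f v u \<delta>"
    and "bilinear_cost G (cost2 G) f x \<le> dual_value2 G v \<delta>"
proof -
  let ?I = "Sigma UNIV (act2 G)"
  have fin: "finite (act2 G s)" for s using wf by (auto simp: wf_game_def)
  define c where "c = (\<lambda>(s, b). mean_cost G (cost2 G) f s b)"
  define E :: "'s option \<Rightarrow> 's \<times> 'b \<Rightarrow> real" where
    "E = case_option (\<lambda>(s, b). 1)
      (\<lambda>s' (s, b). (if s = s' then 1 else 0) - pmf (trans_prob G s b) s')"
  define e :: "'s option \<Rightarrow> real" where "e = case_option 1 (\<lambda>s. 0)"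
  define D where "D = (\<lambda>l (s, b). mean_cost G (con_cost G l) f s b)"
  have c: "(\<Sum>i\<in>?I. c i * y i) = bilinear_cost G (cost2 G) f (curry y)" for y
    by (simp add: sum_Sigma_UNIV fin c_def bilinear_cost_player2)
  have occ: "occupation_measure G (curry y) \<longleftrightarrow>
      (\<forall>i\<in>?I. y i \<ge> 0) \<and> (\<forall>j. (\<Sum>i\<in>?I. E j i * y i) = e j)" for y
    by (simp add: sum_Sigma_UNIV fin E_def e_def occupation_measure_def split_option_all)
  have D: "(\<Sum>i\<in>?I. D l i * y i) = bilinear_cost G (con_cost G l) f (curry y)" for l y
    by (simp add: sum_Sigma_UNIV fin D_def bilinear_cost_player2)
  have x': "(\<forall>i\<in>?I. case_prod x i \<ge> 0) \<and> (\<forall>j. (\<Sum>i\<in>?I. E j i * case_prod x i) = e j)"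
    using x(1) unfolding occ[symmetric] by simp
  have "\<exists>w \<delta>. (\<forall>l\<in>{1..num_con G}. \<delta> l \<ge> 0) \<and>
    (\<forall>i\<in>?I. (\<Sum>j\<in>UNIV. w j * E j i) \<le> c i + (\<Sum>l\<in>{1..num_con G}. \<delta> l * D l i)) \<and>
    (\<Sum>i\<in>?I. c i * case_prod x i) \<le> (\<Sum>j\<in>UNIV. w j * e j) - (\<Sum>l\<in>{1..num_con G}. \<delta> l * con_bound G l)"
  proof (rule lp_strong_duality)
    fix y :: "'s \<times> 'b \<Rightarrow> real"
    assume y: "\<And>i. i \<in> ?I \<Longrightarrow> y i \<ge> 0" "\<And>j. j \<in> UNIV \<Longrightarrow> (\<Sum>i\<in>?I. E j i * y i) = e j"
      "\<And>l. l \<in> {1..num_con G} \<Longrightarrow> (\<Sum>i\<in>?I. D l i * y i) \<le> con_bound G l"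
    have "occupation_measure G (curry y)"
      using y(1,2) unfolding occ by blast
    moreover have "con_feasible G f (curry y)"
      using y(3) unfolding D by (simp add: con_feasible_def)
    ultimately show "(\<Sum>i\<in>?I. c i * case_prod x i) \<le> (\<Sum>i\<in>?I. c i * y i)"
      using opt unfolding c by simp
  next
    show "(\<Sum>i\<in>?I. D l i * case_prod x i) \<le> con_bound G l" if "l \<in> {1..num_con G}" for l
      using that x(2) unfolding D by (simp add: con_feasible_def)
  qed (use x' fin in auto)
  then obtain w \<delta> where w: "\<forall>l\<in>{1..num_con G}. \<delta> l \<ge> 0"
    "\<forall>i\<in>?I. (\<Sum>j\<in>UNIV. w j * E j i) \<le> c i + (\<Sum>l = 1..num_con G. \<delta> l * D l i)"
    "(\<Sum>i\<in>?I. c i * case_prod x i) \<le> (\<Sum>j\<in>UNIV. w j * e j) - (\<Sum>l = 1..num_con G. \<delta> l * con_bound G l)"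
    by blast
  have wE: "(\<Sum>j\<in>UNIV. w j * E j (s, b)) =
      w None + w (Some s) - (\<Sum>s'\<in>UNIV. pmf (trans_prob G s b) s' * w (Some s'))" for s b
    unfolding sum_option by (simp add: E_def sum_kronecker_minus)
  have "dual_certificate2 G f (w None) (\<lambda>s. w (Some s)) \<delta>"
    unfolding dual_certificate2_def
  proof (intro conjI allI ballI)
    fix s b assume "b \<in> act2 G s"
    then show "w None + w (Some s) \<le> mean_cost G (cost2 G) f s b
      + (\<Sum>l = 1..num_con G. \<delta> l * mean_cost G (con_cost G l) f s b)
      + (\<Sum>s'\<in>UNIV. pmf (trans_prob G s b) s' * w (Some s'))"
      using w(2)[rule_format, of "(s, b)"] unfolding wE by (simp add: c_def D_def)
  qed (use w(1) in simp)
  moreover have "bilinear_cost G (cost2 G) f x \<le> dual_value2 G (w None) \<delta>"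
    using w(3) unfolding c by (simp add: dual_value2_def sum_option e_def)
  ultimately show ?thesis by (rule that)
qed

lemma mp_objective_nonneg:
  assumes "mp_feasible G \<eta>"
  shows "mp_objective G \<eta> \<ge> 0"
  using assms weak_duality1[of G "mp_f \<eta>"] weak_duality2[of G "mp_x \<eta>" "mp_f \<eta>"]
  unfolding mp_feasible_iff mp_objective_eq by fastforce

lemma feasible2_of_stationary_iff:
  fixes G :: "('s::finite, 'a, 'b) game"
  assumes "wf_game G" and "unichain G" and "f \<in> stationary1 G" and "g \<in> stationary2 G"
    and "occupation_measure G x" and "normalises2 G g x"
  shows "feasible2 G f (of_stationary g) \<longleftrightarrow> con_feasible G (\<lambda>s. pmf (f s)) x"
  by (simp add: feasible2_def con_feasible_def average_cost_of_stationary[OF assms])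

text \<open>
  In an equilibrium both components solve their linear programs: every competitor \<open>w\<close> or \<open>x'\<close> in the
  program comes from a stationary strategy, against which the equilibrium inequality can be used.
  Strong duality then closes both gaps.
\<close>
lemma nash_equilibrium_yields_zero:
  fixes G :: "('s::finite, 'a, 'b) game"
  assumes "wf_game G" and "unichain G" and nash: "nash_equilibrium G f g"
  shows "\<exists>\<eta>. has_weights1 G f (mp_f \<eta>) \<and> mp_global_min G \<eta> \<and> mp_objective G \<eta> = 0"
proof -
  note game = assms(1,2)
  let ?\<phi> = "\<lambda>s. pmf (f s)"
  have f: "f \<in> stationary1 G" and g: "g \<in> stationary2 G"
    using nash by (auto simp: nash_equilibrium_def)
  obtain x where x: "occupation_measure G x" "normalises2 G g x"
    using occupation_measure_exists[OF assms(1) g] .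
  have weights: "has_weights1 G f ?\<phi>" by (simp add: has_weights1_def)
  have \<phi>: "strategy_weights1 G ?\<phi>" "sub_feasible G ?\<phi>"
    using strategy_weights1_stationary1[OF assms(1) f] feasible1_iff[OF weights] nash
    by (auto simp: nash_equilibrium_def)
  have con: "con_feasible G ?\<phi> x"
    using feasible2_of_stationary_iff[OF game f g x] nash by (simp add: nash_equilibrium_def)
  obtain z \<delta>1 where cert1: "dual_certificate1 G x z \<delta>1"
    "bilinear_cost G (cost1 G) ?\<phi> x \<le> dual_value1 G z \<delta>1"
  proof (rule player1_certificate[OF assms(1) \<phi>])
    fix w assume w: "strategy_weights1 G w" "sub_feasible G w"
    obtain f' where f': "f' \<in> stationary1 G" "has_weights1 G f' w"
      using stationary1_of_weights[OF assms(1) w(1)] .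
    have "average_cost G (cost1 G) f (of_stationary g) \<le> average_cost G (cost1 G) f' (of_stationary g)"
      using nash f'(1) w(2) feasible1_iff[OF f'(2)] by (simp add: nash_equilibrium_def)
    then show "bilinear_cost G (cost1 G) ?\<phi> x \<le> bilinear_cost G (cost1 G) w x"
      unfolding average_cost_of_stationary[OF game f g x] average_cost_of_stationary[OF game f'(1) g x]
        bilinear_cost_cong[OF f'(2)] by simp
  qed
  obtain v u \<delta>2 where cert2: "dual_certificate2 G ?\<phi> v u \<delta>2"
    "bilinear_cost G (cost2 G) ?\<phi> x \<le> dual_value2 G v \<delta>2"
  proof (rule player2_certificate[OF assms(1) x(1) con])
    fix x' assume x': "occupation_measure G x'" "con_feasible G ?\<phi> x'"
    obtain g' where g': "g' \<in> stationary2 G" "normalises2 G g' x'"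
      using normalisation_exists[OF assms(1), of x'] x'(1) by (auto simp: occupation_measure_def)
    have "average_cost G (cost2 G) f (of_stationary g) \<le> average_cost G (cost2 G) f (of_stationary g')"
      using nash of_stationary_history_dep2[OF g'(1)] x'(2)
        feasible2_of_stationary_iff[OF game f g'(1) x'(1) g'(2)]
      by (simp add: nash_equilibrium_def)
    then show "bilinear_cost G (cost2 G) ?\<phi> x \<le> bilinear_cost G (cost2 G) ?\<phi> x'"
      unfolding average_cost_of_stationary[OF game f g x]
        average_cost_of_stationary[OF game f g'(1) x'(1) g'(2)] by simp
  qed
  define \<eta> :: "('s, 'a, 'b) mp_point" where
    "\<eta> = \<lparr>mp_v = v, mp_u = u, mp_z = z, mp_f = ?\<phi>, mp_x = x, mp_d1 = \<delta>1, mp_d2 = \<delta>2\<rparr>"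
  have feas: "mp_feasible G \<eta>"
    using \<phi> x(1) con cert1(1) cert2(1) by (simp add: mp_feasible_iff \<eta>_def)
  have "mp_objective G \<eta> \<le> 0"
    using cert1(2) cert2(2) by (simp add: mp_objective_eq \<eta>_def)
  with mp_objective_nonneg[OF feas] have zero: "mp_objective G \<eta> = 0" by simp
  then have "mp_global_min G \<eta>"
    using feas by (simp add: mp_global_min_def mp_objective_nonneg)
  then show ?thesis
    using zero weights by (intro exI[of _ \<eta>]) (simp add: \<eta>_def)
qed

text \<open>
  Both gaps are nonnegative and add up to 0, so both dual values are attained.  Weak duality bounds the
  deviations of player 1 from below by the dual value, and the Lagrangian bound does so for the
  history-dependent deviations of player 2.
\<close>
lemma zero_yields_nash_equilibrium:
  fixes G :: "('s::finite, 'a, 'b) game"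
  assumes "wf_game G" and "unichain G" and feas: "mp_feasible G \<eta>" and zero: "mp_objective G \<eta> = 0"
    and f: "f \<in> stationary1 G" "has_weights1 G f (mp_f \<eta>)"
    and g: "g \<in> stationary2 G" "normalises2 G g (mp_x \<eta>)"
  shows "nash_equilibrium G f g"
proof -
  note game = assms(1,2)
  let ?\<phi> = "\<lambda>s. pmf (f s)"
  let ?x = "mp_x \<eta>"
  have x: "occupation_measure G ?x" using feas by (simp add: mp_feasible_iff)
  have con: "con_feasible G ?\<phi> ?x"
    using feas by (simp add: mp_feasible_iff con_feasible_def bilinear_cost_cong[OF f(2)])
  have cert1: "dual_certificate1 G ?x (mp_z \<eta>) (mp_d1 \<eta>)" using feas by (simp add: mp_feasible_iff)
  have cert2: "dual_certificate2 G ?\<phi> (mp_v \<eta>) (mp_u \<eta>) (mp_d2 \<eta>)"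
    using feas by (simp add: mp_feasible_iff dual_certificate2_def mean_cost_cong[OF f(2)])
  have \<phi>: "strategy_weights1 G ?\<phi>" "sub_feasible G ?\<phi>"
    using strategy_weights1_stationary1[OF assms(1) f(1)] feas feasible1_iff[OF f(2)]
      feasible1_iff[of G f ?\<phi>] by (auto simp: mp_feasible_iff has_weights1_def)
  have "bilinear_cost G (cost1 G) ?\<phi> ?x \<le> dual_value1 G (mp_z \<eta>) (mp_d1 \<eta>)"
    "bilinear_cost G (cost2 G) ?\<phi> ?x \<le> dual_value2 G (mp_v \<eta>) (mp_d2 \<eta>)"
    using weak_duality1[OF \<phi> cert1] weak_duality2[OF x con cert2] zero
    unfolding mp_objective_eq bilinear_cost_cong[OF f(2)] by linarith+
  note tight = this
  have cost: "average_cost G c f' (of_stationary g) = ereal (bilinear_cost G c (\<lambda>s. pmf (f' s)) ?x)"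
    if "f' \<in> stationary1 G" for c f'
    using average_cost_of_stationary[OF game that g(1) x g(2)] .
  show ?thesis
    unfolding nash_equilibrium_def
  proof (intro conjI ballI impI)
    show "f \<in> stationary1 G" "g \<in> stationary2 G" using f(1) g(1) .
    show "feasible1 G f" using \<phi>(2) by (simp add: feasible1_iff[of G f ?\<phi>] has_weights1_def)
    show "feasible2 G f (of_stationary g)"
      using con feasible2_of_stationary_iff[OF game f(1) g(1) x g(2)] by simp
  next
    fix f' assume f': "f' \<in> stationary1 G" "feasible1 G f'"
    have "sub_feasible G (\<lambda>s. pmf (f' s))"
      using f'(2) by (simp add: feasible1_iff[of G f' "\<lambda>s. pmf (f' s)"] has_weights1_def)
    from weak_duality1[OF strategy_weights1_stationary1[OF assms(1) f'(1)] this cert1]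
    show "average_cost G (cost1 G) f (of_stationary g) \<le> average_cost G (cost1 G) f' (of_stationary g)"
      using tight(1) by (simp add: cost f(1) f'(1))
  next
    fix \<sigma> assume "\<sigma> \<in> history_dep2 G" "feasible2 G f \<sigma>"
    from lagrangian_lower_bound[OF assms(1) f(1) this cert2]
    show "average_cost G (cost2 G) f (of_stationary g) \<le> average_cost G (cost2 G) f \<sigma>"
      using tight(2) by (simp add: cost f(1) order_trans[rotated])
  qed
qed

theorem theorem1:
  fixes G :: "('s::finite, 'a, 'b) game"
  assumes "wf_game G"
    and "\<exists>f\<in>stationary1 G. \<exists>g\<in>stationary2 G. feasible1 G f \<and> feasible2 G f (of_stationary g)"
    and "unichain G"
    and "strong_slater G"
  shows "(\<forall>f g. nash_equilibrium G f g \<longrightarrow>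
            (\<exists>\<eta>. has_weights1 G f (mp_f \<eta>) \<and> mp_global_min G \<eta> \<and> mp_objective G \<eta> = 0)) \<and>
         (\<forall>\<eta> :: ('s, 'a, 'b) mp_point. mp_global_min G \<eta> \<and> mp_objective G \<eta> = 0 \<longrightarrow>
            (\<exists>f\<in>stationary1 G. has_weights1 G f (mp_f \<eta>) \<and>
              (\<exists>g\<in>stationary2 G. normalises2 G g (mp_x \<eta>)) \<and>
              (\<forall>g\<in>stationary2 G. normalises2 G g (mp_x \<eta>) \<longrightarrow> nash_equilibrium G f g)))"
proof (intro conjI allI impI)
  fix f g assume "nash_equilibrium G f g"
  then show "\<exists>\<eta>. has_weights1 G f (mp_f \<eta>) \<and> mp_global_min G \<eta> \<and> mp_objective G \<eta> = 0"
    using nash_equilibrium_yields_zero assms by blast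
next
  fix \<eta> :: "('s, 'a, 'b) mp_point"
  assume "mp_global_min G \<eta> \<and> mp_objective G \<eta> = 0"
  then have \<eta>: "mp_feasible G \<eta>" "mp_objective G \<eta> = 0" by (auto simp: mp_global_min_def)
  obtain f where f: "f \<in> stationary1 G" "has_weights1 G f (mp_f \<eta>)"
    using stationary1_of_weights[OF assms(1)] \<eta>(1) by (auto simp: mp_feasible_iff)
  obtain g where "g \<in> stationary2 G" "normalises2 G g (mp_x \<eta>)"
    using normalisation_exists[OF assms(1), of "mp_x \<eta>"] \<eta>(1)
    by (auto simp: mp_feasible_iff occupation_measure_def)
  then show "\<exists>f\<in>stationary1 G. has_weights1 G f (mp_f \<eta>) \<and>
      (\<exists>g\<in>stationary2 G. normalises2 G g (mp_x \<eta>)) \<and>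
      (\<forall>g\<in>stationary2 G. normalises2 G g (mp_x \<eta>) \<longrightarrow> nash_equilibrium G f g)"
    using f zero_yields_nash_equilibrium[OF assms(1,3) \<eta> f] by blast
qed

end
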